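(* Let $T$ be a simplicial tree and let $G$ be a group acting on $T$ by graph automorphisms. Assume that: (1) for every $x \in \mathrm{Vert}(T)\cup\partial T$, the power alternative holds for the stabiliser $\mathrm{Stab}_G(x)$; (2) the action of $G$ on $T$ has the stabilisation property. Then the power alternative holds for $G$.
   Context: A group $G$ satisfies the power alternative if for every $g,h\in G$ there exists an integer $n\ge 1$ such that either $g^n$ and $h^n$ commute or $\langle g^n,h^n\rangle\cong F_2$ (the free group of rank 2). A simplicial tree is viewed as a metric space (a real tree) with its path metric in which every edge has length $1$; $\mathrm{Vert}(T)$ is its vertex set and $\partial T$ its Gromov boundary. A geodesic in $T$ is an isometric embedding of an interval $I\subseteq\mathbb R$ into $T$ (segment, ray or line), identified with its image. Stabilisation property: an action of a group $G$ by isometries on a real tree $T$ has the stabilisation property if the following holds. Let $\{\gamma_n\}_{n\ge1}$ be any sequence of geodesics of $T$ that is monotonic for inclusion (either $\gamma_n\subset\gamma_{n+1}$ for all $n$, or $\gamma_{n+1}\subset\gamma_n$ for all $n$), let $\ell(\gamma_n)\in\mathbb R_{\ge0}\cup\{+\infty\}$ be the length of $\gamma_n$ and let $H_n\le G$ be the pointwise stabiliser of $\gamma_n$. If $\ell(\gamma_n)\to+\infty$, then there exists $N\ge1$ such that $H_n=H_{n+1}$ for all $n\ge N$. *)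

theory Defs
  imports
    "HOL-Analysis.Analysis"
    "HOL-Algebra.Group_Action"
    "HOL-Algebra.Generated_Groups"
begin

section \<open>Free groups and the power alternative\<close>

text \<open>The letter \<^term>\<open>(a, True)\<close> stands for the generator \<open>a\<close> and
  \<^term>\<open>(a, False)\<close> for its inverse; the elements of the free group are the reduced words.\<close>

type_synonym 'a letter = "'a \<times> bool"

definition inverse_letters :: "'a letter \<Rightarrow> 'a letter \<Rightarrow> bool" where
  "inverse_letters x y \<longleftrightarrow> fst x = fst y \<and> snd x \<noteq> snd y"

definition reduced_word :: "'a letter list \<Rightarrow> bool" where
  "reduced_word = successively (\<lambda>x y. \<not> inverse_letters x y)"

fun cons_reduce :: "'a letter \<Rightarrow> 'a letter list \<Rightarrow> 'a letter list" where
  "cons_reduce x [] = [x]"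
| "cons_reduce x (y # w) = (if inverse_letters x y then w else x # y # w)"

definition free_group :: "'a set \<Rightarrow> 'a letter list monoid" where
  "free_group S =
    \<lparr>carrier = {w. reduced_word w \<and> fst ` set w \<subseteq> S},
     mult = (\<lambda>v w. foldr cons_reduce v w),
     one = []\<rparr>"

abbreviation F2 :: "bool letter list monoid" where
  "F2 \<equiv> free_group UNIV"

lemma reduced_word_cons_reduce: "reduced_word w \<Longrightarrow> reduced_word (cons_reduce x w)"
  by (cases w) (auto simp: reduced_word_def successively_Cons)

lemma reduced_word_foldr: "reduced_word w \<Longrightarrow> reduced_word (foldr cons_reduce v w)"
  by (induction v) (auto intro: reduced_word_cons_reduce)

lemma set_cons_reduce: "set (cons_reduce x w) \<subseteq> insert x (set w)"
  by (cases w) auto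

lemma set_foldr_cons_reduce: "set (foldr cons_reduce v w) \<subseteq> set v \<union> set w"
  by (induction v) (use set_cons_reduce in fastforce)+

lemma cons_reduce_cancel:
  assumes "inverse_letters x y" "reduced_word w"
  shows "cons_reduce x (cons_reduce y w) = w"
proof (cases w)
  case (Cons z w')
  show ?thesis
  proof (cases "inverse_letters y z")
    case True
    then have "x = z" using assms by (auto simp: inverse_letters_def prod_eq_iff)
    with True Cons assms show ?thesis by (cases w') (auto simp: reduced_word_def)
  qed (use Cons assms in auto)
qed (use assms in auto)

lemma foldr_cons_reduce:
  assumes "reduced_word u"
  shows "foldr cons_reduce (cons_reduce x w) u = cons_reduce x (foldr cons_reduce w u)"
  using assms by (cases w) (auto simp: cons_reduce_cancel reduced_word_foldr)

lemma foldr_cons_reduce_assoc: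
  assumes "reduced_word u"
  shows "foldr cons_reduce (foldr cons_reduce v w) u
    = foldr cons_reduce v (foldr cons_reduce w u)"
  using assms by (induction v) (auto simp: foldr_cons_reduce)

lemma foldr_cons_reduce_Nil: "reduced_word w \<Longrightarrow> foldr cons_reduce w [] = w"
proof (induction w)
  case (Cons x w)
  then show ?case by (cases w) (auto simp: reduced_word_def)
qed simp

lemma foldr_cons_reduce_inverse:
  "reduced_word u \<Longrightarrow>
    foldr cons_reduce (rev (map (\<lambda>(a, b). (a, \<not> b)) w)) (foldr cons_reduce w u) = u"
  by (induction w) (auto simp: cons_reduce_cancel reduced_word_foldr inverse_letters_def)

lemma reduced_word_inverse:
  "reduced_word w \<Longrightarrow> reduced_word (rev (map (\<lambda>(a, b). (a, \<not> b)) w))"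
  unfolding reduced_word_def successively_rev successively_map
  by (erule successively_mono) (auto simp: inverse_letters_def)

lemma group_free_group: "group (free_group S)"
proof (rule groupI)
  fix x assume x: "x \<in> carrier (free_group S)"
  let ?y = "rev (map (\<lambda>(a, b). (a, \<not> b)) x)"
  have "fst ` set ?y = fst ` set x" by (force simp: image_iff)
  with x have "?y \<in> carrier (free_group S)"
    by (simp add: free_group_def reduced_word_inverse)
  moreover have "?y \<otimes>\<^bsub>free_group S\<^esub> x = \<one>\<^bsub>free_group S\<^esub>"
    using x foldr_cons_reduce_inverse[of "[]" x]
    by (simp add: free_group_def foldr_cons_reduce_Nil) (simp add: reduced_word_def)
  ultimately show "\<exists>y\<in>carrier (free_group S). y \<otimes>\<^bsub>free_group S\<^esub> x = \<one>\<^bsub>free_group S\<^esub>" ..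
next
  fix x y assume "x \<in> carrier (free_group S)" "y \<in> carrier (free_group S)"
  then show "x \<otimes>\<^bsub>free_group S\<^esub> y \<in> carrier (free_group S)"
    using set_foldr_cons_reduce[of x y] by (fastforce simp: free_group_def reduced_word_foldr)
qed (auto simp: free_group_def foldr_cons_reduce_assoc reduced_word_def)

definition power_alternative :: "('g, 'm) monoid_scheme \<Rightarrow> bool" where
  "power_alternative G \<longleftrightarrow>
    (\<forall>g\<in>carrier G. \<forall>h\<in>carrier G. \<exists>n::nat. n \<ge> 1 \<and>
      (g [^]\<^bsub>G\<^esub> n \<otimes>\<^bsub>G\<^esub> h [^]\<^bsub>G\<^esub> n = h [^]\<^bsub>G\<^esub> n \<otimes>\<^bsub>G\<^esub> g [^]\<^bsub>G\<^esub> n \<or>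
       G\<lparr>carrier := generate G {g [^]\<^bsub>G\<^esub> n, h [^]\<^bsub>G\<^esub> n}\<rparr> \<cong> F2))"

section \<open>Geodesics, boundary and the stabilisation property\<close>

text \<open>In this section a metric space is a carrier \<open>X\<close> with a distance \<open>d\<close>, and \<open>\<psi>\<close> is an action
  of \<open>G\<close> on \<open>X\<close>.\<close>

definition geodesic :: "'p set \<Rightarrow> ('p \<Rightarrow> 'p \<Rightarrow> real) \<Rightarrow> real set \<Rightarrow> (real \<Rightarrow> 'p) \<Rightarrow> bool" where
  "geodesic X d I c \<longleftrightarrow>
    is_interval I \<and> I \<noteq> {} \<and> c ` I \<subseteq> X \<and> (\<forall>s\<in>I. \<forall>t\<in>I. d (c s) (c t) = \<bar>s - t\<bar>)"

definition pointwise_stabilizer ::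
    "('g, 'm) monoid_scheme \<Rightarrow> ('g \<Rightarrow> 'p \<Rightarrow> 'p) \<Rightarrow> 'p set \<Rightarrow> 'g set" where
  "pointwise_stabilizer G \<psi> A = {g \<in> carrier G. \<forall>x\<in>A. \<psi> g x = x}"

text \<open>The length of a geodesic is the length of its parameter interval.\<close>

definition stabilisation_property ::
    "('g, 'm) monoid_scheme \<Rightarrow> 'p set \<Rightarrow> ('p \<Rightarrow> 'p \<Rightarrow> real) \<Rightarrow> ('g \<Rightarrow> 'p \<Rightarrow> 'p) \<Rightarrow> bool" where
  "stabilisation_property G X d \<psi> \<longleftrightarrow>
    (\<forall>(I :: nat \<Rightarrow> real set) (c :: nat \<Rightarrow> real \<Rightarrow> 'p).
      (\<forall>n. geodesic X d (I n) (c n)) \<longrightarrow>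
      ((\<forall>n. c n ` I n \<subseteq> c (Suc n) ` I (Suc n)) \<or>
       (\<forall>n. c (Suc n) ` I (Suc n) \<subseteq> c n ` I n)) \<longrightarrow>
      (\<lambda>n. emeasure lborel (I n)) \<longlonglongrightarrow> \<infinity> \<longrightarrow>
      (\<exists>N. \<forall>n\<ge>N. pointwise_stabilizer G \<psi> (c n ` I n)
                 = pointwise_stabilizer G \<psi> (c (Suc n) ` I (Suc n))))"

text \<open>The boundary consists of the classes of asymptotic geodesic rays. Rays are extensional on
  \<^term>\<open>{0..} :: real set\<close>, since otherwise their arbitrary values at negative
  arguments would keep the image of a class under an isometry of \<open>X\<close> from being a class.\<close>

definition geodesic_rays :: "'p set \<Rightarrow> ('p \<Rightarrow> 'p \<Rightarrow> real) \<Rightarrow> (real \<Rightarrow> 'p) set" where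
  "geodesic_rays X d = {r \<in> extensional {0..}. geodesic X d {0..} r}"

definition asymptotic :: "'p set \<Rightarrow> ('p \<Rightarrow> 'p \<Rightarrow> real) \<Rightarrow> ((real \<Rightarrow> 'p) \<times> (real \<Rightarrow> 'p)) set" where
  "asymptotic X d = {(r, s). r \<in> geodesic_rays X d \<and> s \<in> geodesic_rays X d \<and>
    (\<exists>K. \<forall>t\<ge>0. d (r t) (s t) \<le> K)}"

definition gromov_boundary :: "'p set \<Rightarrow> ('p \<Rightarrow> 'p \<Rightarrow> real) \<Rightarrow> (real \<Rightarrow> 'p) set set" where
  "gromov_boundary X d = geodesic_rays X d // asymptotic X d"

definition boundary_action ::
    "('g \<Rightarrow> 'p \<Rightarrow> 'p) \<Rightarrow> 'g \<Rightarrow> (real \<Rightarrow> 'p) set \<Rightarrow> (real \<Rightarrow> 'p) set" where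
  "boundary_action \<psi> g \<xi> = (\<lambda>r. compose {0..} (\<psi> g) r) ` \<xi>"

section \<open>Simplicial trees and their geometric realisation\<close>

text \<open>A simplicial graph has a vertex set \<open>V\<close> and a set \<open>E\<close> of edges, each edge being the set of its
  two endpoints.\<close>

definition walk :: "'v set \<Rightarrow> 'v set set \<Rightarrow> 'v list \<Rightarrow> bool" where
  "walk V E xs \<longleftrightarrow> xs \<noteq> [] \<and> set xs \<subseteq> V \<and> successively (\<lambda>u v. {u, v} \<in> E) xs"

definition simple_cycle :: "'v set \<Rightarrow> 'v set set \<Rightarrow> 'v list \<Rightarrow> bool" where
  "simple_cycle V E xs \<longleftrightarrow>
    walk V E xs \<and> distinct xs \<and> length xs \<ge> 3 \<and> {last xs, hd xs} \<in> E"

definition simplicial_tree :: "'v set \<Rightarrow> 'v set set \<Rightarrow> bool" where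
  "simplicial_tree V E \<longleftrightarrow>
    V \<noteq> {} \<and> (\<forall>e\<in>E. \<exists>u\<in>V. \<exists>v\<in>V. u \<noteq> v \<and> e = {u, v}) \<and>
    (\<forall>u\<in>V. \<forall>v\<in>V. \<exists>xs. walk V E xs \<and> hd xs = u \<and> last xs = v) \<and>
    (\<nexists>xs. simple_cycle V E xs)"

definition graph_automorphism :: "'v set \<Rightarrow> 'v set set \<Rightarrow> ('v \<Rightarrow> 'v) \<Rightarrow> bool" where
  "graph_automorphism V E f \<longleftrightarrow>
    bij_betw f V V \<and> (\<forall>u\<in>V. \<forall>v\<in>V. {u, v} \<in> E \<longleftrightarrow> {f u, f v} \<in> E)"

definition cells :: "'v set \<Rightarrow> 'v set set \<Rightarrow> 'v set set" where
  "cells V E = {{v} |v. v \<in> V} \<union> E"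

definition supp :: "('v \<Rightarrow> real) \<Rightarrow> 'v set" where
  "supp p = {v. p v \<noteq> 0}"

text \<open>Points are given by their barycentric coordinates.\<close>

definition realisation :: "'v set \<Rightarrow> 'v set set \<Rightarrow> ('v \<Rightarrow> real) set" where
  "realisation V E = {p. (\<forall>v. p v \<ge> 0) \<and> supp p \<in> cells V E \<and> (\<Sum>v\<in>supp p. p v) = 1}"

text \<open>On a closed edge \<open>{u, v}\<close> we have \<open>p v = 1 - p u\<close>, so the following is
  \<open>\<bar>p u - q u\<bar>\<close>, the distance in a unit interval.\<close>

definition cell_dist :: "('v \<Rightarrow> real) \<Rightarrow> ('v \<Rightarrow> real) \<Rightarrow> real" where
  "cell_dist p q = (\<Sum>v\<in>supp p \<union> supp q. \<bar>p v - q v\<bar>) / 2"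

text \<open>The path metric is the infimum of the lengths of piecewise linear paths, a path being given
  by its successive break points, any two consecutive ones lying in a common closed cell.\<close>

definition pl_path :: "'v set \<Rightarrow> 'v set set \<Rightarrow> ('v \<Rightarrow> real) list \<Rightarrow> bool" where
  "pl_path V E ps \<longleftrightarrow> ps \<noteq> [] \<and> set ps \<subseteq> realisation V E \<and>
    successively (\<lambda>p q. \<exists>c\<in>cells V E. supp p \<union> supp q \<subseteq> c) ps"

definition pl_length :: "('v \<Rightarrow> real) list \<Rightarrow> real" where
  "pl_length ps = (\<Sum>(p, q)\<leftarrow>zip ps (tl ps). cell_dist p q)"

definition path_metric :: "'v set \<Rightarrow> 'v set set \<Rightarrow> ('v \<Rightarrow> real) \<Rightarrow> ('v \<Rightarrow> real) \<Rightarrow> real" where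
  "path_metric V E p q = Inf {pl_length ps |ps. pl_path V E ps \<and> hd ps = p \<and> last ps = q}"

text \<open>The action on the realisation extends the action on the vertices affinely on each edge.\<close>

definition realised_action ::
    "'v set \<Rightarrow> 'v set set \<Rightarrow> ('g \<Rightarrow> 'v \<Rightarrow> 'v) \<Rightarrow> 'g \<Rightarrow> ('v \<Rightarrow> real) \<Rightarrow> 'v \<Rightarrow> real" where
  "realised_action V E \<phi> g = (\<lambda>p\<in>realisation V E. \<lambda>w. \<Sum>v\<in>{v \<in> supp p. \<phi> g v = w}. p v)"

end

theory Submission
  imports Defs
begin

text \<open>
  Each \<open>g \<in> G\<close> either has a power fixing a vertex or translates a line \<open>A\<close>, its axis.

  If \<open>g\<close> and \<open>h\<close> both have elliptic powers, choose vertices \<open>x\<close>, \<open>y\<close> fixed by powers of \<open>g\<close> and \<open>h\<close>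
  at minimal distance. Either \<open>x = y\<close> and a vertex stabiliser contains powers of both, or, by
  minimality, no power of \<open>g\<close> fixes the first edge and no power of \<open>h\<close> the last edge of \<open>[x, y]\<close>, and
  the half-trees beyond these edges play ping-pong.

  If both have axes \<open>A\<close> and \<open>B\<close>, either the axes share a ray, whose end is fixed by \<open>g\<close> and \<open>h\<close>, or no
  vertex projects far out on both, and large powers play ping-pong with the sets of vertices that
  project far out on \<open>A\<close> and on \<open>B\<close>.

  If \<open>g\<close> has axis \<open>A\<close> and \<open>h\<close> fixes \<open>y\<close>, the stabilisation property applied to segments of \<open>A\<close> yields
  a length such that an element fixing a segment of \<open>A\<close> of that length fixes \<open>A\<close> pointwise. Either a
  power of \<open>h\<close> fixes \<open>A\<close>, hence its ends, or no power of \<open>h\<close> maps a long subsegment of \<open>A\<close> starting at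
  the projection of \<open>y\<close> into \<open>A\<close>, and ping-pong is played with the vertices that project far from,
  respectively near to, that point.
\<close>

section \<open>Ping-pong\<close>

definition letter_value :: "('g, 'm) monoid_scheme \<Rightarrow> ('a \<Rightarrow> 'g) \<Rightarrow> 'a letter \<Rightarrow> 'g" where
  "letter_value G f x = (if snd x then f (fst x) else inv\<^bsub>G\<^esub> f (fst x))"

definition word_value :: "('g, 'm) monoid_scheme \<Rightarrow> ('a \<Rightarrow> 'g) \<Rightarrow> 'a letter list \<Rightarrow> 'g" where
  "word_value G f w = foldr (\<lambda>x y. letter_value G f x \<otimes>\<^bsub>G\<^esub> y) w \<one>\<^bsub>G\<^esub>"

lemma word_value_Nil [simp]: "word_value G f [] = \<one>\<^bsub>G\<^esub>"
  by (simp add: word_value_def)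

lemma word_value_Cons [simp]:
  "word_value G f (x # w) = letter_value G f x \<otimes>\<^bsub>G\<^esub> word_value G f w"
  by (simp add: word_value_def)

context group
begin

lemma letter_value_closed:
  "range f \<subseteq> carrier G \<Longrightarrow> letter_value G f x \<in> carrier G"
  by (auto simp: letter_value_def)

lemma word_value_closed:
  "range f \<subseteq> carrier G \<Longrightarrow> word_value G f w \<in> carrier G"
  by (induction w) (auto simp: letter_value_closed)

lemma word_value_cons_reduce:
  assumes "range f \<subseteq> carrier G"
  shows "word_value G f (cons_reduce x w) = letter_value G f x \<otimes> word_value G f w"
proof (cases w)
  case (Cons y w')
  show ?thesis
  proof (cases "inverse_letters x y")
    case True
    have c: "f (fst y) \<in> carrier G" "word_value G f w' \<in> carrier G"
      using assms by (auto simp: word_value_closed)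
    have "letter_value G f x \<otimes> (letter_value G f y \<otimes> word_value G f w') = word_value G f w'"
      using True c by (auto simp: letter_value_def inverse_letters_def m_assoc[symmetric])
    with True Cons show ?thesis by simp
  qed (use Cons in auto)
qed simp

lemma word_value_mult:
  assumes "range f \<subseteq> carrier G"
  shows "word_value G f (foldr cons_reduce v w) = word_value G f v \<otimes> word_value G f w"
  using assms
  by (induction v) (auto simp: word_value_cons_reduce m_assoc letter_value_closed word_value_closed)

text \<open>Evaluation of words is a homomorphism onto the generated subgroup, and
  \<open>nontrivial\<close> says that its kernel is trivial. A family \<open>f\<close> instead of a
  set keeps the generators labelled; its injectivity is forced, since otherwise a reduced word of
  length two would have value \<open>\<one>\<close>.\<close>

lemma generate_iso_free_group:
  fixes f :: "'c \<Rightarrow> 'a"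
  assumes f: "range f \<subseteq> carrier G"
    and nontrivial: "\<And>w. reduced_word w \<Longrightarrow> w \<noteq> [] \<Longrightarrow> word_value G f w \<noteq> \<one>"
  shows "G\<lparr>carrier := generate G (range f)\<rparr> \<cong> free_group (UNIV :: 'c set)"
proof -
  let ?F = "free_group (UNIV :: 'c set)" and ?e = "word_value G f"
  interpret F: group ?F by (rule group_free_group)
  have hom: "?e \<in> hom ?F G"
    using f by (auto simp: hom_def free_group_def word_value_closed word_value_mult)
  interpret e: group_hom ?F G ?e
    by unfold_locales (rule hom)
  have inj: "inj_on ?e (carrier ?F)"
  proof (subst e.inj_on_one_iff, intro allI impI)
    fix w assume "w \<in> carrier ?F" "?e w = \<one>"
    then show "w = \<one>\<^bsub>?F\<^esub>"
      using nontrivial[of w] by (auto simp: free_group_def)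
  qed
  have img: "?e ` carrier ?F = generate G (range f)"
  proof
    have "?e w \<in> generate G (range f)" for w
    proof (induction w)
      case (Cons x w)
      have "letter_value G f x \<in> generate G (range f)"
        by (auto simp: letter_value_def intro: generate.incl generate.inv)
      with Cons show ?case by (auto intro: generate.eng)
    qed (auto intro: generate.one)
    then show "?e ` carrier ?F \<subseteq> generate G (range f)" by auto
    have "f c \<in> ?e ` carrier ?F" for c
      using f by (intro image_eqI[of _ _ "[(c, True)]"])
        (simp_all add: letter_value_def free_group_def reduced_word_def range_subsetD)
    then show "generate G (range f) \<subseteq> ?e ` carrier ?F"
      by (intro generate_subgroup_incl e.img_is_subgroup) auto
  qed
  have "?e \<in> iso ?F (G\<lparr>carrier := generate G (range f)\<rparr>)"
    using hom inj img by (auto simp: iso_def hom_def bij_betw_def)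
  then have "?F \<cong> G\<lparr>carrier := generate G (range f)\<rparr>"
    by (rule is_isoI)
  then show ?thesis by (rule F.iso_sym)
qed

end

section \<open>Ping-pong for group actions\<close>

context group_action
begin

lemma action_closed: "g \<in> carrier G \<Longrightarrow> x \<in> E \<Longrightarrow> \<phi> g x \<in> E"
  by (rule element_image) auto

lemma action_mult:
  "g \<in> carrier G \<Longrightarrow> h \<in> carrier G \<Longrightarrow> x \<in> E \<Longrightarrow> \<phi> (g \<otimes> h) x = \<phi> g (\<phi> h x)"
  by (rule composition_rule) auto

lemma action_one: "x \<in> E \<Longrightarrow> \<phi> \<one> x = x"
  using id_eq_one by (metis restrict_apply')

lemma action_inv_left: "g \<in> carrier G \<Longrightarrow> x \<in> E \<Longrightarrow> \<phi> (inv g) (\<phi> g x) = x"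
  by (metis action_mult action_one group.inv_closed group.l_inv group_hom group_hom_def)

text \<open>A reduced word splits into syllables, nonzero powers of one generator. Each syllable
  throws \<open>z\<close> and the set of the other generator into its own set, so a nonempty word
  carries \<open>z\<close> into some \<open>X c\<close>, and \<open>z\<close> lies in none of
  these.\<close>

lemma ping_pong_base_point:
  fixes f :: "bool \<Rightarrow> 'a" and X :: "bool \<Rightarrow> 'c set"
  assumes f: "range f \<subseteq> carrier G" and z: "z \<in> E" "\<And>c. z \<notin> X c" and X: "\<And>c. X c \<subseteq> E"
    and pp: "\<And>c k t. k \<noteq> (0::int) \<Longrightarrow> t \<in> insert z (X (\<not> c)) \<Longrightarrow> \<phi> (f c [^] k) t \<in> X c"
  shows "G\<lparr>carrier := generate G (range f)\<rparr> \<cong> F2"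
proof -
  interpret group G using group_hom by (rule group_hom.axioms)
  let ?l = "letter_value G f" and ?e = "word_value G f"
  have fc: "f c \<in> carrier G" for c using f by auto
  have lpow: "?l x [^] (k::nat) = f (fst x) [^] (if snd x then int k else - int k)" for x k
    using fc by (auto simp: letter_value_def int_pow_int int_pow_neg nat_pow_inv)
  have lX: "\<phi> (?l x [^] k) t \<in> X (fst x)"
    if "k \<ge> 1" "t \<in> insert z (X (\<not> fst x))" for x t and k :: nat
    unfolding lpow using that by (intro pp) auto
  \<comment> \<open>Membership of the image in \<open>X (fst x)\<close> is too weak for the
    induction, as nothing is assumed about powers of \<open>f c\<close> on \<open>X c\<close>. The
    leading syllable \<open>?l x [^] k\<close> is therefore kept together with the point
    \<open>t\<close> it acts on; a repeated letter only raises \<open>k\<close>.\<close>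
  have main: "\<exists>t\<in>insert z (X (\<not> fst x)). \<exists>k\<ge>(1::nat). \<phi> (?e (x # w)) z = \<phi> (?l x [^] k) t"
    if "reduced_word (x # w)" for x w
    using that
  proof (induction w arbitrary: x)
    case Nil
    have "\<phi> (?e [x]) z = \<phi> (?l x [^] (1::nat)) z"
      using f by (simp add: letter_value_closed)
    then show ?case by blast
  next
    case (Cons y w)
    have "reduced_word (y # w)" and ninv: "\<not> inverse_letters x y"
      using Cons.prems by (auto simp: reduced_word_def)
    with Cons.IH obtain t k where t: "t \<in> insert z (X (\<not> fst y))" "k \<ge> (1::nat)"
      "\<phi> (?e (y # w)) z = \<phi> (?l y [^] k) t" by blast
    have tE: "t \<in> E" using t z X by blast
    have split: "\<phi> (?e (x # y # w)) z = \<phi> (?l x) (\<phi> (?e (y # w)) z)"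
      unfolding word_value_Cons[of _ _ x]
      using f z word_value_closed[OF f, of "y # w"] by (intro action_mult) (auto simp: letter_value_closed)
    show ?case
    proof (cases "fst x = fst y")
      case True
      with ninv have xy: "x = y" by (auto simp: inverse_letters_def prod_eq_iff)
      have "\<phi> (?l x) (\<phi> (?l x [^] k) t) = \<phi> (?l x \<otimes> ?l x [^] k) t"
        using f tE by (intro action_mult[symmetric]) (auto simp: letter_value_closed)
      also have "?l x \<otimes> ?l x [^] k = ?l x [^] Suc k"
        using f by (intro nat_pow_Suc2[symmetric] letter_value_closed)
      finally have "\<phi> (?e (x # y # w)) z = \<phi> (?l x [^] Suc k) t"
        using split t xy by simp
      then show ?thesis using t xy by (intro bexI[of _ t] exI[of _ "Suc k"]) auto
    next
      case False
      then have "fst y = (\<not> fst x)" by auto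
      then have "\<phi> (?e (y # w)) z \<in> X (\<not> fst x)"
        using lX[OF t(2,1)] unfolding t(3) by simp
      moreover have "\<phi> (?e (x # y # w)) z = \<phi> (?l x [^] (1::nat)) (\<phi> (?e (y # w)) z)"
        unfolding split using f by (simp add: letter_value_closed)
      ultimately show ?thesis by blast
    qed
  qed
  show ?thesis
  proof (rule generate_iso_free_group[OF f])
    fix w :: "bool letter list" assume w: "reduced_word w" "w \<noteq> []"
    obtain x w' where [simp]: "w = x # w'" using w by (cases w) auto
    obtain t k where tk: "t \<in> insert z (X (\<not> fst x))" "k \<ge> (1::nat)" "\<phi> (?e w) z = \<phi> (?l x [^] k) t"
      using main[of x w'] w by auto
    have "\<phi> (?e w) z \<in> X (fst x)" unfolding tk(3) by (rule lX[OF tk(2,1)])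
    moreover have "\<phi> \<one> z \<notin> X (fst x)" using z by (simp add: action_one)
    ultimately show "?e w \<noteq> \<one>" by auto
  qed
qed

text \<open>Passing to squares makes room for a base point outside both ping-pong sets: no power of
  \<open>a\<^sup>2\<close> carries \<open>P\<close> or \<open>a x\<^sub>0\<close> onto \<open>a x\<^sub>0\<close>.\<close>

lemma ping_pong_squares:
  assumes ab: "a \<in> carrier G" "b \<in> carrier G"
    and PQ: "P \<subseteq> E" "Q \<subseteq> E" "P \<inter> Q = {}" and x0: "x0 \<in> P"
    and aP: "\<And>k x. k \<noteq> (0::int) \<Longrightarrow> x \<in> P \<Longrightarrow> \<phi> (a [^] k) x \<in> Q"
    and bQ: "\<And>k x. k \<noteq> (0::int) \<Longrightarrow> x \<in> Q \<Longrightarrow> \<phi> (b [^] k) x \<in> P"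
  shows "G\<lparr>carrier := generate G {a [^] (2::nat), b [^] (2::nat)}\<rparr> \<cong> F2"
proof -
  interpret group G using group_hom by (rule group_hom.axioms)
  define z where "z = \<phi> a x0"
  have zQ: "z \<in> Q" using aP[of 1 x0] x0 ab by (simp add: z_def int_pow_1)
  define f where "f c = (if c then a [^] (2::nat) else b [^] (2::nat))" for c
  define X where "X c = (if c then Q - {z} else P)" for c
  have pw: "(a [^] (2::nat)) [^] (k::int) = a [^] (2 * k)"
    "(b [^] (2::nat)) [^] (k::int) = b [^] (2 * k)" for k
    using ab int_pow_pow[of a 2 k] int_pow_pow[of b 2 k]
    by (simp_all add: int_pow_int[symmetric])
  have zE: "z \<in> E" using zQ PQ by auto
  have comp: "\<phi> (a [^] (k::int)) (\<phi> (a [^] (l::int)) x) = \<phi> (a [^] (k + l)) x" if "x \<in> E" for k l x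
    using that ab by (simp add: action_mult[symmetric] int_pow_mult)
  have z1: "z = \<phi> (a [^] (1::int)) x0" using ab by (simp add: z_def int_pow_1)
  have x0E: "x0 \<in> E" using x0 PQ by auto
  have shift_back: "\<phi> (a [^] (k - 1)) x = x0" if "\<phi> (a [^] k) x = z" "x \<in> E" for x and k :: int
  proof -
    have "\<phi> (a [^] (-1::int)) (\<phi> (a [^] k) x) = \<phi> (a [^] (-1::int)) (\<phi> (a [^] (1::int)) x0)"
      using that z1 by simp
    then show ?thesis unfolding comp[OF that(2)] comp[OF x0E] by (simp add: x0E action_one)
  qed
  \<comment> \<open>If \<open>a [^] k\<close> sends \<open>x\<close> to \<open>z\<close>, then
    \<open>a [^] (k - 1)\<close> sends \<open>x\<close> to \<open>x0\<close>, a point of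
    \<open>P\<close> and not of \<open>Q\<close>. Only \<open>k = 1\<close> permits this, and the
    exponents used below are even or, at \<open>x0\<close>, odd and different from 1.\<close>
  have ne: "\<phi> (a [^] k) x \<noteq> z" if "x \<in> P" "k \<noteq> 1" for x and k :: int
  proof
    assume "\<phi> (a [^] k) x = z"
    with that shift_back have "\<phi> (a [^] (k - 1)) x = x0" using PQ by blast
    moreover have "\<phi> (a [^] (k - 1)) x \<in> Q" using that by (intro aP) auto
    ultimately show False using x0 PQ by auto
  qed
  have "G\<lparr>carrier := generate G (range f)\<rparr> \<cong> F2"
  proof (rule ping_pong_base_point)
    show "range f \<subseteq> carrier G" using ab by (auto simp: f_def)
    show "z \<in> E" by fact
    show "z \<notin> X c" for c using zQ PQ by (auto simp: X_def)
    show "X c \<subseteq> E" for c using PQ by (auto simp: X_def)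
    fix c t and k :: int assume k: "k \<noteq> 0" and t: "t \<in> insert z (X (\<not> c))"
    show "\<phi> (f c [^] k) t \<in> X c"
    proof (cases c)
      case True
      have odd: "2 * k \<noteq> 1" "2 * k + 1 \<noteq> 0" by presburger+
      consider "t = z" | "t \<in> P" using t True by (auto simp: X_def)
      then have "\<phi> (a [^] (2 * k)) t \<in> Q - {z}"
      proof cases
        case 1
        then have "\<phi> (a [^] (2 * k)) t = \<phi> (a [^] (2 * k + 1)) x0"
          using z1 comp[OF x0E] by simp
        then show ?thesis using aP[OF odd(2) x0] ne[OF x0] k by auto
      next
        case 2
        then show ?thesis using aP[of "2 * k" t] ne[of t "2 * k"] k odd by auto
      qed
      then show ?thesis using True by (simp add: f_def X_def pw)
    next
      case False
      then have "t \<in> Q" using t zQ by (auto simp: X_def)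
      then show ?thesis using bQ[of "2 * k" t] k False by (simp add: f_def X_def pw)
    qed
  qed
  moreover have "range f = {a [^] (2::nat), b [^] (2::nat)}"
    by (auto simp: f_def image_def)
  ultimately show ?thesis by simp
qed

text \<open>The form in which ping-pong is applied: it suffices that \<open>g [^] p\<close> and
  \<open>h [^] q\<close> play. The exponent \<open>p * q\<close> serves both generators, and the
  further factor 2 pays for the base point.\<close>

lemma ping_pong_powers:
  assumes gh: "g \<in> carrier G" "h \<in> carrier G" and pq: "p \<ge> 1" "q \<ge> (1::nat)"
    and PQ: "P \<subseteq> E" "Q \<subseteq> E" "P \<inter> Q = {}" "P \<noteq> {}"
    and gP: "\<And>k x. k \<noteq> (0::int) \<Longrightarrow> x \<in> P \<Longrightarrow> \<phi> (g [^] (int p * k)) x \<in> Q"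
    and hQ: "\<And>k x. k \<noteq> (0::int) \<Longrightarrow> x \<in> Q \<Longrightarrow> \<phi> (h [^] (int q * k)) x \<in> P"
  shows "\<exists>n::nat\<ge>1. G\<lparr>carrier := generate G {g [^] n, h [^] n}\<rparr> \<cong> F2"
proof -
  interpret group G using group_hom by (rule group_hom.axioms)
  let ?a = "g [^] (p * q)" and ?b = "h [^] (p * q)"
  have pw: "?a [^] (k::int) = g [^] (int p * (int q * k))"
    "?b [^] (k::int) = h [^] (int q * (int p * k))" for k
    using gh int_pow_pow[of g "int (p * q)" k] int_pow_pow[of h "int (p * q)" k]
    by (simp_all add: int_pow_int[symmetric] ac_simps)
  obtain x0 where "x0 \<in> P" using PQ by auto
  then have "G\<lparr>carrier := generate G {?a [^] (2::nat), ?b [^] (2::nat)}\<rparr> \<cong> F2"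
    using gh PQ pq gP hQ by (intro ping_pong_squares[where P = P and Q = Q]) (auto simp: pw)
  moreover have "?a [^] (2::nat) = g [^] (p * q * 2)" "?b [^] (2::nat) = h [^] (p * q * 2)"
    using gh by (simp_all only: nat_pow_pow)
  moreover have "p * q * 2 \<ge> 1" using pq by simp
  ultimately show ?thesis by metis
qed

end

section \<open>Distance, geodesics and projections in a tree\<close>

lemma walk_Cons:
  "walk V E (x # xs) \<longleftrightarrow> x \<in> V \<and> (xs = [] \<or> {x, hd xs} \<in> E \<and> walk V E xs)"
  by (cases xs) (auto simp: walk_def)

lemma walk_append:
  "walk V E (xs @ ys) \<longleftrightarrow>
    (if xs = [] then walk V E ys else if ys = [] then walk V E xs
     else walk V E xs \<and> walk V E ys \<and> {last xs, hd ys} \<in> E)"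
  by (auto simp: walk_def successively_append_iff)

lemma walk_rev: "walk V E (rev xs) \<longleftrightarrow> walk V E xs"
  by (simp add: walk_def insert_commute)

text \<open>Cutting out the stretch between two visits to one vertex shortens a walk without
  changing its ends or adding vertices. Applied to a walk avoiding some vertex, this gives a simple
  walk avoiding it.\<close>

lemma walk_distinct:
  assumes "walk V E xs"
  shows "\<exists>ys. walk V E ys \<and> hd ys = hd xs \<and> last ys = last xs \<and> set ys \<subseteq> set xs \<and> distinct ys"
  using assms
proof (induction "length xs" arbitrary: xs rule: less_induct)
  case less
  show ?case
  proof (cases "distinct xs")
    case False
    then obtain as a bs cs where xs: "xs = as @ [a] @ bs @ [a] @ cs"
      using not_distinct_decomp by blast
    let ?zs = "as @ [a] @ cs"
    have "walk V E ?zs"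
      using less.prems unfolding xs by (auto simp: walk_append walk_Cons split: if_splits)
    moreover have "length ?zs < length xs" "hd ?zs = hd xs" "last ?zs = last xs" "set ?zs \<subseteq> set xs"
      unfolding xs by (auto simp: hd_append)
    ultimately show ?thesis using less.hyps[of ?zs] by (metis subset_trans)
  qed (use less in auto)
qed

text \<open>A walk with \<open>n\<close> edges has \<open>Suc n\<close> entries. Values are taken in
  \<open>int\<close> so that subtraction is not truncated and distances compare directly with index
  differences on lines indexed by the integers.\<close>

definition vdist :: "'v set \<Rightarrow> 'v set set \<Rightarrow> 'v \<Rightarrow> 'v \<Rightarrow> int" where
  "vdist V E u v = int (LEAST n. \<exists>xs. walk V E xs \<and> hd xs = u \<and> last xs = v \<and> length xs = Suc n)"

locale tree_graph =
  fixes V :: "'v set" and E :: "'v set set"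
  assumes tree: "simplicial_tree V E"
begin

abbreviation d :: "'v \<Rightarrow> 'v \<Rightarrow> int" where "d \<equiv> vdist V E"

lemma edgeD:
  assumes "{u, v} \<in> E"
  shows "u \<in> V" "v \<in> V" "u \<noteq> v"
  using assms tree unfolding simplicial_tree_def by (metis doubleton_eq_iff)+

lemma ex_shortest_walk:
  assumes "u \<in> V" "v \<in> V"
  shows "\<exists>xs. walk V E xs \<and> hd xs = u \<and> last xs = v \<and> int (length xs) = d u v + 1"
proof -
  obtain xs where xs: "walk V E xs" "hd xs = u" "last xs = v"
    using assms tree unfolding simplicial_tree_def by blast
  then have "\<exists>n xs. walk V E xs \<and> hd xs = u \<and> last xs = v \<and> length xs = Suc n"
    by (metis length_greater_0_conv Suc_pred walk_def)
  then have "\<exists>xs. walk V E xs \<and> hd xs = u \<and> last xs = v \<and>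
      length xs = Suc (LEAST n. \<exists>xs. walk V E xs \<and> hd xs = u \<and> last xs = v \<and> length xs = Suc n)"
    by (rule LeastI_ex)
  then show ?thesis unfolding vdist_def by auto
qed

lemma d_le_walk: "walk V E xs \<Longrightarrow> d (hd xs) (last xs) \<le> int (length xs) - 1"
proof -
  assume w: "walk V E xs"
  then obtain n where n: "length xs = Suc n" by (cases xs) (auto simp: walk_def)
  have "(LEAST n. \<exists>ys. walk V E ys \<and> hd ys = hd xs \<and> last ys = last xs \<and> length ys = Suc n) \<le> n"
    using w n by (intro Least_le) auto
  then show ?thesis using n by (simp add: vdist_def)
qed

lemma d_nonneg [simp]: "d u v \<ge> 0"
  by (simp add: vdist_def)

lemma d_self [simp]: "u \<in> V \<Longrightarrow> d u u = 0"
  using d_le_walk[of "[u]"] by (simp add: walk_def order_antisym)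

lemma d_eq_0: "u \<in> V \<Longrightarrow> v \<in> V \<Longrightarrow> d u v = 0 \<longleftrightarrow> u = v"
proof
  assume "u \<in> V" "v \<in> V" "d u v = 0"
  then obtain xs where "hd xs = u" "last xs = v" "length xs = 1"
    using ex_shortest_walk[of u v] by auto
  then show "u = v" by (cases xs) auto
qed auto

lemma d_commute_le: "u \<in> V \<Longrightarrow> v \<in> V \<Longrightarrow> d u v \<le> d v u"
proof -
  assume "u \<in> V" "v \<in> V"
  then obtain xs where xs: "walk V E xs" "hd xs = v" "last xs = u" "int (length xs) = d v u + 1"
    using ex_shortest_walk by blast
  then have "xs \<noteq> []" by (auto simp: walk_def)
  then show ?thesis using d_le_walk[of "rev xs"] xs by (simp add: walk_rev hd_rev last_rev)
qed

lemma d_commute: "u \<in> V \<Longrightarrow> v \<in> V \<Longrightarrow> d u v = d v u"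
  by (simp add: d_commute_le order_antisym)

lemma d_triangle:
  assumes "u \<in> V" "v \<in> V" "w \<in> V"
  shows "d u w \<le> d u v + d v w"
proof -
  obtain xs where xs: "walk V E xs" "hd xs = u" "last xs = v" "int (length xs) = d u v + 1"
    using ex_shortest_walk assms by blast
  obtain ys where ys: "walk V E ys" "hd ys = v" "last ys = w" "int (length ys) = d v w + 1"
    using ex_shortest_walk assms by blast
  obtain ys' where ys': "ys = v # ys'" using ys by (cases ys) (auto simp: walk_def)
  have ne: "xs \<noteq> []" using xs by (auto simp: walk_def)
  have "walk V E (xs @ ys')"
    using xs ys unfolding ys' by (auto simp: walk_append walk_Cons)
  moreover have "last (xs @ ys') = w" using xs ys ys' by auto
  ultimately show ?thesis using d_le_walk[of "xs @ ys'"] xs ys ne unfolding ys' by simp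
qed

lemma d_edge:
  assumes "{u, v} \<in> E"
  shows "d u v = 1"
proof -
  have "d u v \<le> 1" using d_le_walk[of "[u, v]"] edgeD[OF assms] assms by (simp add: walk_def)
  moreover have "d u v \<noteq> 0" using d_eq_0 edgeD[OF assms] by simp
  ultimately show ?thesis using d_nonneg[of u v] by linarith
qed

lemma ex_closer_neighbour:
  assumes "u \<in> V" "v \<in> V" "u \<noteq> v"
  shows "\<exists>w. {u, w} \<in> E \<and> d w v = d u v - 1"
proof -
  obtain xs where xs: "walk V E xs" "hd xs = u" "last xs = v" "int (length xs) = d u v + 1"
    using ex_shortest_walk assms by blast
  then obtain ys where ys: "xs = u # ys" by (cases xs) (auto simp: walk_def)
  have ne: "ys \<noteq> []" using xs ys assms by auto
  have w: "walk V E ys" "{u, hd ys} \<in> E" using xs ne unfolding ys by (auto simp: walk_Cons)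
  have "d (hd ys) v \<le> d u v - 1" using d_le_walk[OF w(1)] xs ys ne by simp
  moreover have "d u v \<le> 1 + d (hd ys) v"
    using d_triangle[of u "hd ys" v] edgeD[OF w(2)] assms d_edge[OF w(2)] by simp
  ultimately show ?thesis using w(2) by (intro exI[of _ "hd ys"]) auto
qed

lemma edge_if_d_1:
  assumes "u \<in> V" "v \<in> V" "d u v = 1"
  shows "{u, v} \<in> E"
proof -
  have "u \<noteq> v" using assms by auto
  then obtain w where "{u, w} \<in> E" "d w v = 0" using ex_closer_neighbour assms by force
  then show ?thesis using d_eq_0 edgeD assms by metis
qed

text \<open>If both neighbours of \<open>u\<close> were no further from \<open>r\<close> than \<open>u\<close>, they could be joined through \<open>r\<close>
  outside \<open>u\<close>, and such a walk closes up through \<open>u\<close> to a cycle.\<close>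

lemma neighbour_further:
  assumes r: "r \<in> V" and uv: "{u, v} \<in> E" and uw: "{u, w} \<in> E" and "v \<noteq> w" and rv: "d r v \<le> d r u"
  shows "d r w = d r u + 1"
proof (rule ccontr)
  assume c: "d r w \<noteq> d r u + 1"
  have V: "u \<in> V" "v \<in> V" "w \<in> V" using uv uw edgeD by blast+
  have "d r w \<le> d r u + 1" using d_triangle[of r u w] d_edge[OF uw] V r by simp
  with c have rw: "d r w \<le> d r u" by simp
  \<comment> \<open>A shortest walk from \<open>r\<close> to \<open>x\<close> that passed
    \<open>u\<close> would reach \<open>u\<close> before its last vertex, making \<open>u\<close>
    strictly closer to \<open>r\<close> than \<open>x\<close>.\<close>
  have avoid: "\<exists>xs. walk V E xs \<and> hd xs = r \<and> last xs = x \<and> u \<notin> set xs"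
    if x: "{u, x} \<in> E" "d r x \<le> d r u" for x
  proof -
    have xV: "x \<in> V" "u \<noteq> x" using edgeD x by blast+
    obtain xs where xs: "walk V E xs" "hd xs = r" "last xs = x" "int (length xs) = d r x + 1"
      using ex_shortest_walk r xV by blast
    have "u \<notin> set xs"
    proof
      assume "u \<in> set xs"
      then obtain as bs where s: "xs = as @ u # bs" by (meson split_list)
      have "bs \<noteq> []" using xs(3) xV s by auto
      then have "length (as @ [u]) < length xs" using s by simp
      moreover have "walk V E (as @ [u])" using xs s by (auto simp: walk_append walk_Cons split: if_splits)
      moreover have "hd (as @ [u]) = r" using xs s by (cases as) auto
      ultimately have "d r u < d r x" using d_le_walk[of "as @ [u]"] xs by auto
      then show False using x by simp
    qed
    with xs show ?thesis by blast
  qed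
  obtain xs where xs: "walk V E xs" "hd xs = r" "last xs = v" "u \<notin> set xs"
    using avoid uv rv by blast
  obtain ys where ys: "walk V E ys" "hd ys = r" "last ys = w" "u \<notin> set ys"
    using avoid uw rw by blast
  have ne: "xs \<noteq> []" "ys \<noteq> []" using xs ys by (auto simp: walk_def)
  obtain ys' where ys': "ys = r # ys'" using ys ne by (cases ys) auto
  have "walk V E (rev xs @ ys')"
    using xs ys ne unfolding ys' by (auto simp: walk_append walk_Cons walk_rev last_rev)
  moreover have "hd (rev xs @ ys') = v" using xs ne by (simp add: hd_rev hd_append)
  moreover have "last (rev xs @ ys') = w"
    using xs ys ne unfolding ys' by (auto simp: last_rev)
  ultimately obtain zs where zs: "walk V E zs" "hd zs = v" "last zs = w"
    "set zs \<subseteq> set (rev xs @ ys')" "distinct zs"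
    using walk_distinct by metis
  have "u \<notin> set zs" using zs xs ys unfolding ys' by auto
  moreover have "length zs \<ge> 2"
    using zs \<open>v \<noteq> w\<close> by (cases zs; cases "tl zs") (auto simp: walk_def)
  moreover have "walk V E (zs @ [u])"
    using zs(1) uw V by (auto simp: walk_append walk_Cons zs(3) insert_commute)
  moreover have "hd (zs @ [u]) = v" using zs by (auto simp: walk_def hd_append)
  ultimately have "simple_cycle V E (zs @ [u])"
    using zs uv by (auto simp: simple_cycle_def)
  then show False using tree by (auto simp: simplicial_tree_def)
qed

text \<open>Trees are bipartite. If both ends were equally far from \<open>r\<close>, then
  \<open>u\<close> would have two neighbours not further from \<open>r\<close> than itself, namely
  \<open>v\<close> and one on the way to \<open>r\<close>, against
  \<open>neighbour_further\<close>.\<close>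

lemma d_edge_cases:
  assumes r: "r \<in> V" and uv: "{u, v} \<in> E"
  shows "d r v = d r u + 1 \<or> d r v = d r u - 1"
proof (rule ccontr)
  assume c: "\<not> ?thesis"
  have V: "u \<in> V" "v \<in> V" "d u v = 1" "d v u = 1"
    using uv edgeD d_edge[OF uv] d_commute by metis+
  have eq: "d r v = d r u" using c d_triangle[of r u v] d_triangle[of r v u] V r by simp
  then have "r \<noteq> u" using V by auto
  then obtain w where w: "{u, w} \<in> E" "d w r = d u r - 1" using ex_closer_neighbour V r by metis
  then have dw: "d r w = d r u - 1" using d_commute edgeD V r by metis
  then have "v \<noteq> w" using eq by auto
  then show False using neighbour_further[OF r uv w(1)] eq dw by simp
qed

text \<open>The edge separates \<open>y\<close> from \<open>v\<close>, so the geodesic between them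
  crosses it. The induction pushes the edge one step towards \<open>v\<close>; by
  \<open>neighbour_further\<close> the next edge again leads away from \<open>y\<close>.\<close>

lemma d_through_edge:
  assumes "y \<in> V" "v \<in> V" "{p, q} \<in> E" "d y q = d y p + 1" "d v p = d v q + 1"
  shows "d y v = d y p + 1 + d q v"
  using assms(3-)
proof (induction "nat (d v q)" arbitrary: p q)
  case 0
  then have "d v q = 0" using d_nonneg[of v q] by linarith
  then have "v = q" using d_eq_0 assms edgeD 0 by blast
  then show ?case using 0 assms by simp
next
  case (Suc n)
  have q: "q \<in> V" "p \<in> V" "v \<noteq> q" using edgeD[OF Suc.prems(1)] Suc.hyps(2) assms by auto
  then obtain q' where q': "{q, q'} \<in> E" "d q' v = d q v - 1"
    using ex_closer_neighbour assms by metis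
  have q'V: "q' \<in> V" using edgeD q' by blast
  have vq': "d v q' = d v q - 1" using q' d_commute q q'V assms by metis
  then have "p \<noteq> q'" using Suc.prems by auto
  have qp: "{q, p} \<in> E" using Suc.prems by (simp add: insert_commute)
  have yq': "d y q' = d y q + 1"
    using neighbour_further[OF assms(1) qp q'(1) \<open>p \<noteq> q'\<close>] Suc.prems by simp
  have "d y v = d y q + 1 + d q' v"
    using Suc.hyps vq' q'(1) yq' by (intro Suc.hyps(1)) auto
  then show ?case using Suc.prems q'(2) by simp
qed

text \<open>Uniqueness of geodesics. Walking back from \<open>v\<close>, the neighbours of
  \<open>v\<close> towards \<open>p\<close> and towards \<open>q\<close> are both closer to
  \<open>y\<close>; since \<open>v\<close> has only one neighbour closer to \<open>y\<close>, they
  agree.\<close>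

lemma geodesic_point_unique:
  assumes "y \<in> V" "v \<in> V" "p \<in> V" "q \<in> V"
    and "d y p + d p v = d y v" "d y q + d q v = d y v" "d y p = d y q"
  shows "p = q"
  using assms(2,5,6)
proof (induction "nat (d p v)" arbitrary: v)
  case 0
  then have "d p v = 0" "d q v = 0" using assms(7) d_nonneg[of p v] by linarith+
  then show ?case using d_eq_0 assms 0 by metis
next
  case (Suc n)
  have ne: "p \<noteq> v" "q \<noteq> v" using Suc.prems Suc.hyps(2) assms by auto
  have step: "\<exists>w. {v, w} \<in> E \<and> d s w = d s v - 1 \<and> d y w = d y v - 1"
    if s: "s \<in> V" "s \<noteq> v" "d y s + d s v = d y v" for s
  proof -
    obtain w where w: "{v, w} \<in> E" "d w s = d v s - 1"
      using ex_closer_neighbour s Suc.prems by metis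
    have wV: "w \<in> V" using edgeD w by blast
    have "d s w = d s v - 1" using w d_commute wV s Suc.prems by metis
    moreover from this have "d y w \<le> d y v - 1"
      using d_triangle[of y s w] s wV assms by simp
    moreover have "d y v \<le> d y w + 1"
      using d_triangle[of y w v] d_edge[OF w(1)] d_commute wV assms Suc.prems by metis
    ultimately show ?thesis using w by auto
  qed
  obtain w where w: "{v, w} \<in> E" "d p w = d p v - 1" "d y w = d y v - 1"
    using step[of p] assms Suc.prems ne by blast
  obtain w' where w': "{v, w'} \<in> E" "d q w' = d q v - 1" "d y w' = d y v - 1"
    using step[of q] assms Suc.prems ne by blast
  have "w = w'" using neighbour_further[OF assms(1) w(1) w'(1)] w(3) w'(3) by force
  moreover have "w \<in> V" using edgeD w by blast
  ultimately show ?case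
    using Suc.hyps w w' Suc.prems by (intro Suc.hyps(1)[of w]) auto
qed

lemma ex_geodesic:
  assumes "x \<in> V" "y \<in> V"
  shows "\<exists>P. P 0 = x \<and> P (d x y) = y \<and> (\<forall>k. 0 \<le> k \<and> k < d x y \<longrightarrow> {P k, P (k + 1)} \<in> E)"
  using assms
proof (induction "nat (d x y)" arbitrary: x)
  case 0
  then have "x = y" using d_eq_0 d_nonneg[of x y] by (metis nat_0_iff order_antisym)
  then show ?case using 0 by auto
next
  case (Suc n)
  then have "x \<noteq> y" by auto
  then obtain w where w: "{x, w} \<in> E" "d w y = d x y - 1"
    using ex_closer_neighbour Suc.prems by metis
  then obtain P where P: "P 0 = w" "P (d w y) = y" "\<forall>k. 0 \<le> k \<and> k < d w y \<longrightarrow> {P k, P (k + 1)} \<in> E"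
    using Suc.hyps(1)[of w] Suc.hyps(2) Suc.prems edgeD by force
  define Q where "Q k = (if k = 0 then x else P (k - 1))" for k
  have "d x y > 0" using Suc.hyps(2) by simp
  moreover have "{Q k, Q (k + 1)} \<in> E" if "0 \<le> k" "k < d x y" for k
  proof (cases "k = 0")
    case False
    then have "{P (k - 1), P (k - 1 + 1)} \<in> E" using P(3)[rule_format, of "k - 1"] w that by simp
    then show ?thesis using False that by (simp add: Q_def)
  qed (use w P in \<open>simp add: Q_def\<close>)
  ultimately show ?case using P w by (intro exI[of _ Q]) (auto simp: Q_def)
qed

text \<open>The edges bound the distances along \<open>P\<close> from above; a strict inequality
  anywhere would make the ends closer than \<open>d x y\<close>.\<close>

lemma ex_geodesic_isometric:
  assumes "x \<in> V" "y \<in> V"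
  shows "\<exists>P. P 0 = x \<and> P (d x y) = y \<and> (\<forall>k. 0 \<le> k \<and> k < d x y \<longrightarrow> {P k, P (k + 1)} \<in> E) \<and>
    (\<forall>k. 0 \<le> k \<and> k \<le> d x y \<longrightarrow> P k \<in> V) \<and>
    (\<forall>k l. 0 \<le> k \<and> k \<le> l \<and> l \<le> d x y \<longrightarrow> d (P k) (P l) = l - k)"
proof -
  obtain P where P: "P 0 = x" "P (d x y) = y" "\<And>k. 0 \<le> k \<Longrightarrow> k < d x y \<Longrightarrow> {P k, P (k + 1)} \<in> E"
    using ex_geodesic[OF assms] by blast
  have V: "P k \<in> V" if "0 \<le> k" "k \<le> d x y" for k
    using that assms P edgeD(1)[OF P(3), of k] by (cases "k = d x y") auto
  have le: "d (P k) (P l) \<le> l - k" if kl: "0 \<le> k" "k \<le> l" "l \<le> d x y" for k l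
    using kl(2,3)
  proof (induction l rule: int_ge_induct)
    case base
    then show ?case using V kl by simp
  next
    case (step l)
    have "d (P l) (P (l + 1)) = 1" using step kl by (intro d_edge P(3)) auto
    then show ?case using step kl V d_triangle[of "P k" "P l" "P (l + 1)"] by simp
  qed
  have "d (P k) (P l) = l - k" if kl: "0 \<le> k" "k \<le> l" "l \<le> d x y" for k l
  proof -
    have "d x y \<le> d x (P k) + d (P k) (P l) + d (P l) y"
      using d_triangle[of x "P k" y] d_triangle[of "P k" "P l" y] V kl assms by simp
    moreover have "d x (P k) \<le> k" "d (P l) y \<le> d x y - l"
      using le[of 0 k] le[of l "d x y"] P kl by auto
    ultimately show ?thesis using le[OF kl] by simp
  qed
  then show ?thesis using P V by blast
qed

section \<open>Geodesic lines and projections onto them\<close>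

definition geodesic_line :: "(int \<Rightarrow> 'v) \<Rightarrow> bool" where
  "geodesic_line A \<longleftrightarrow> (\<forall>i. A i \<in> V) \<and> (\<forall>i j. d (A i) (A j) = \<bar>i - j\<bar>)"

lemma geodesic_lineD:
  assumes "geodesic_line A"
  shows "A i \<in> V" "d (A i) (A j) = \<bar>i - j\<bar>" "{A i, A (i + 1)} \<in> E" "{A i, A (i - 1)} \<in> E"
  using assms by (auto simp: geodesic_line_def intro!: edge_if_d_1)

lemma geodesic_line_reverse: "geodesic_line A \<Longrightarrow> geodesic_line (\<lambda>i. A (- i))"
  by (auto simp: geodesic_line_def)

lemma geodesic_line_shift: "geodesic_line A \<Longrightarrow> geodesic_line (\<lambda>i. A (i + m))"
  by (auto simp: geodesic_line_def)

text \<open>In a tree, a path that never turns back is geodesic: by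
  \<open>neighbour_further\<close>, each further step increases the distance from
  \<open>A i\<close>. Two consecutive distances are carried through the induction because the next
  one depends on both.\<close>

lemma geodesic_lineI:
  assumes e: "\<And>i. {A i, A (i + 1)} \<in> E" and nb: "\<And>i. A i \<noteq> A (i + 2)"
  shows "geodesic_line A"
proof -
  have V: "A i \<in> V" for i using edgeD e by blast
  have *: "d (A i) (A (i + int n)) = int n \<and> d (A i) (A (i + int n + 1)) = int n + 1" for i n
  proof (induction n)
    case 0
    then show ?case using d_edge[OF e] V by simp
  next
    case (Suc n)
    have e': "{A (i + int n + 1), A (i + int n)} \<in> E" using e by (simp add: insert_commute)
    have e'': "{A (i + int n + 1), A (i + int n + 2)} \<in> E"
      using e[of "i + int n + 1"] by (simp add: add.assoc)
    have "d (A i) (A (i + int n + 2)) = d (A i) (A (i + int n + 1)) + 1"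
      using neighbour_further[OF V e' e'' nb] Suc by simp
    then show ?case using Suc by (simp add: ac_simps)
  qed
  have **: "d (A i) (A j) = j - i" if "i \<le> j" for i j
    using *[of i "nat (j - i)"] that by simp
  show ?thesis unfolding geodesic_line_def
  proof (intro conjI allI V)
    fix i j show "d (A i) (A j) = \<bar>i - j\<bar>"
      using **[of i j] **[of j i] d_commute[OF V V, of i j] by (cases "i \<le> j") auto
  qed
qed

lemma d_line_increasing:
  assumes A: "geodesic_line A" and v: "v \<in> V" and inc: "d v (A (i + 1)) = d v (A i) + 1" and "j \<ge> i"
  shows "d v (A j) = d v (A i) + (j - i)"
proof (cases "j = i")
  case False
  have "d (A j) (A i) = d (A j) (A (i + 1)) + 1"
    using False \<open>j \<ge> i\<close> by (simp add: geodesic_lineD[OF A])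
  then show ?thesis
    using d_through_edge[OF v geodesic_lineD(1)[OF A] geodesic_lineD(3)[OF A] inc, of j] False \<open>j \<ge> i\<close>
    by (simp add: geodesic_lineD[OF A])
qed simp

text \<open>Take \<open>i\<close> with \<open>A i\<close> nearest to \<open>v\<close>. Since
  adjacent vertices are never equally far from \<open>v\<close>, both edges of the line at
  \<open>A i\<close> lead away from \<open>v\<close>, and a line that starts to move away from
  \<open>v\<close> keeps doing so.\<close>

lemma ex_projection:
  assumes A: "geodesic_line A" and v: "v \<in> V"
  shows "\<exists>i. \<forall>j. d v (A j) = d v (A i) + \<bar>j - i\<bar>"
proof -
  obtain i where "\<forall>j. nat (d v (A i)) \<le> nat (d v (A j))"
    using ex_has_least_nat[of "\<lambda>_. True" "0::int" "\<lambda>i. nat (d v (A i))"] by auto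
  then have min: "d v (A i) \<le> d v (A j)" for j
    by (metis d_nonneg nat_le_eq_zle)
  have up: "d v (A (i + 1)) = d v (A i) + 1"
    using d_edge_cases[OF v geodesic_lineD(3)[OF A, of i]] min[of "i + 1"] by auto
  have down: "d v (A (i - 1)) = d v (A i) + 1"
    using d_edge_cases[OF v geodesic_lineD(4)[OF A, of i]] min[of "i - 1"] by auto
  have "d v (A j) = d v (A i) + \<bar>j - i\<bar>" for j
  proof (cases "j \<ge> i")
    case True
    then show ?thesis using d_line_increasing[OF A v up, of j] by simp
  next
    case False
    then show ?thesis
      using d_line_increasing[OF geodesic_line_reverse[OF A] v, of "- i" "- j"] down by simp
  qed
  then show ?thesis by blast
qed

text \<open>Nearest-point projection, recorded as the index on \<open>A\<close> and not as the
  vertex, so that translations of the line become additions. For a geodesic line and a vertex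
  \<open>v\<close> there is exactly one such index.\<close>

definition proj :: "(int \<Rightarrow> 'v) \<Rightarrow> 'v \<Rightarrow> int" where
  "proj A v = (SOME i. \<forall>j. d v (A j) = d v (A i) + \<bar>j - i\<bar>)"

lemma d_proj:
  assumes "geodesic_line A" "v \<in> V"
  shows "d v (A j) = d v (A (proj A v)) + \<bar>j - proj A v\<bar>"
  using someI_ex[OF ex_projection[OF assms]] unfolding proj_def by blast

lemma proj_eqI:
  assumes A: "geodesic_line A" "v \<in> V" and "\<And>j. d v (A j) = c + \<bar>j - i\<bar>"
  shows "proj A v = i"
  using d_proj[OF A, of i] assms(3)[of i] assms(3)[of "proj A v"] by linarith

lemma proj_line: "geodesic_line A \<Longrightarrow> proj A (A i) = i"
  by (rule proj_eqI[where c = 0]) (auto simp: geodesic_lineD)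

text \<open>The geodesic from \<open>y\<close> to \<open>v\<close> enters the line at
  \<open>A 0\<close> and leaves it at \<open>A (s * m)\<close>, because the edge from
  \<open>A 0\<close> to \<open>A s\<close> separates \<open>y\<close> from \<open>v\<close>. The
  sign \<open>s\<close> treats both directions of the line at once.\<close>

lemma line_on_geodesic:
  assumes A: "geodesic_line A" and V: "y \<in> V" "v \<in> V" and s: "s = 1 \<or> s = -1"
    and y: "proj A y = 0" and pv: "proj A v = s * m" and t: "0 \<le> t" "t \<le> m" and m: "0 < m"
  shows "d y (A (s * t)) = d y (A 0) + t" "d (A (s * t)) v = d (A (proj A v)) v + (m - t)"
    "d y (A (s * t)) + d (A (s * t)) v = d y v"
proof -
  note [simp] = geodesic_lineD[OF A]
  have dy: "d y (A j) = d y (A 0) + \<bar>j\<bar>" for j using d_proj[OF A V(1), of j] by (simp add: y)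
  have dv: "d v (A j) = d v (A (proj A v)) + \<bar>j - s * m\<bar>" for j
    using d_proj[OF A V(2), of j] by (simp only: pv)
  have dv': "d (A j) v = d (A (proj A v)) v + \<bar>j - s * m\<bar>" for j
    using dv[of j] V d_commute geodesic_lineD(1)[OF A] by metis
  show a: "d y (A (s * t)) = d y (A 0) + t" using dy[of "s * t"] s t by auto
  show b: "d (A (s * t)) v = d (A (proj A v)) v + (m - t)" using dv'[of "s * t"] s t by auto
  show "d y (A (s * t)) + d (A (s * t)) v = d y v"
  proof -
    have "{A 0, A s} \<in> E" using s geodesic_lineD[OF A, of 0] by auto
    moreover have "d y (A s) = d y (A 0) + 1" using dy[of s] s by auto
    moreover have "d v (A 0) = d v (A s) + 1" using dv[of 0] dv[of s] s t m by auto
    ultimately have "d y v = d y (A 0) + 1 + d (A s) v" by (rule d_through_edge[OF V])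
    then show ?thesis using a b dv'[of s] s t m by auto
  qed
qed

end

section \<open>The path metric on the realisation\<close>

definition edge_point :: "'v \<Rightarrow> 'v \<Rightarrow> real \<Rightarrow> 'v \<Rightarrow> real" where
  "edge_point a b t = (\<lambda>w. (1 - t) * of_bool (w = a) + t * of_bool (w = b))"

definition vertex_point :: "'v \<Rightarrow> 'v \<Rightarrow> real" where
  "vertex_point a = (\<lambda>w. of_bool (w = a))"

definition line_point :: "(int \<Rightarrow> 'v) \<Rightarrow> real \<Rightarrow> 'v \<Rightarrow> real" where
  "line_point A t = edge_point (A \<lfloor>t\<rfloor>) (A (\<lfloor>t\<rfloor> + 1)) (frac t)"

text \<open>A function on the vertices, extended affinely over each edge. If it changes by at most 1
  along edges, the extension is 1-Lipschitz for the path metric, which is how lower bounds for that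
  metric are obtained.\<close>

definition affine_extension :: "('v \<Rightarrow> int) \<Rightarrow> ('v \<Rightarrow> real) \<Rightarrow> real" where
  "affine_extension f p = (\<Sum>v\<in>supp p. p v * of_int (f v))"

lemma edge_point_0: "edge_point a b 0 = vertex_point a"
  and edge_point_1: "edge_point a b 1 = vertex_point b"
  by (auto simp: edge_point_def vertex_point_def)

lemma vertex_point_eq_iff: "vertex_point a = vertex_point b \<longleftrightarrow> a = b"
  by (auto simp: vertex_point_def fun_eq_iff of_bool_def split: if_splits)

lemma supp_edge_point: "supp (edge_point a b t) \<subseteq> {a, b}"
  by (auto simp: supp_def edge_point_def)

lemma affine_extension_superset:
  assumes "finite S" "supp p \<subseteq> S"
  shows "affine_extension f p = (\<Sum>v\<in>S. p v * of_int (f v))"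
  unfolding affine_extension_def using assms
  by (intro sum.mono_neutral_left) (auto simp: supp_def)

lemma affine_extension_edge_point:
  "affine_extension f (edge_point a b t) = (1 - t) * of_int (f a) + t * of_int (f b)"
proof -
  have "affine_extension f (edge_point a b t) = (\<Sum>v\<in>{a, b}. edge_point a b t v * of_int (f v))"
    by (intro affine_extension_superset supp_edge_point) auto
  then show ?thesis by (cases "a = b") (auto simp: edge_point_def algebra_simps)
qed

lemma cell_dist_superset:
  assumes "finite S" "supp p \<subseteq> S" "supp q \<subseteq> S"
  shows "cell_dist p q = (\<Sum>v\<in>S. \<bar>p v - q v\<bar>) / 2"
proof -
  have "(\<Sum>v\<in>supp p \<union> supp q. \<bar>p v - q v\<bar>) = (\<Sum>v\<in>S. \<bar>p v - q v\<bar>)"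
    using assms by (intro sum.mono_neutral_left) (auto simp: supp_def)
  then show ?thesis by (simp add: cell_dist_def)
qed

lemma cell_dist_nonneg [simp]: "cell_dist p q \<ge> 0"
  by (simp add: cell_dist_def sum_nonneg)

lemma cell_dist_edge_point:
  "a \<noteq> b \<Longrightarrow> cell_dist (edge_point a b s) (edge_point a b t) = \<bar>s - t\<bar>"
  using supp_edge_point[of a b s] supp_edge_point[of a b t]
  by (subst cell_dist_superset[of "{a, b}"]) (simp_all add: edge_point_def abs_minus_commute)

lemma line_point_edge_point:
  assumes "of_int k \<le> t" "t \<le> of_int k + 1"
  shows "line_point A t = edge_point (A k) (A (k + 1)) (t - of_int k)"
proof (cases "t = of_int k + 1")
  case True
  then have "\<lfloor>t\<rfloor> = k + 1" "frac t = 0" by (auto simp: frac_def)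
  with True show ?thesis by (simp add: line_point_def edge_point_0 edge_point_1)
next
  case False
  then have "\<lfloor>t\<rfloor> = k" using assms by linarith
  then show ?thesis by (simp add: line_point_def frac_def)
qed

lemma line_point_of_int: "line_point A (of_int k) = vertex_point (A k)"
  by (simp add: line_point_def edge_point_0)

lemma pl_length_Cons [simp]: "pl_length (p # q # ps) = cell_dist p q + pl_length (q # ps)"
  and pl_length_single [simp]: "pl_length [p] = 0"
  by (auto simp: pl_length_def)

lemma pl_path_Cons:
  "pl_path V E (p # q # ps) \<longleftrightarrow>
    p \<in> realisation V E \<and> (\<exists>c\<in>cells V E. supp p \<union> supp q \<subseteq> c) \<and> pl_path V E (q # ps)"
  by (auto simp: pl_path_def)

lemma pl_length_nonneg: "pl_length ps \<ge> 0"
  unfolding pl_length_def by (rule sum_list_nonneg) auto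

lemma pl_path_append:
  assumes "pl_path V E ps" "pl_path V E qs" "last ps = hd qs"
  shows "pl_path V E (ps @ tl qs) \<and> hd (ps @ tl qs) = hd ps \<and> last (ps @ tl qs) = last qs \<and>
    pl_length (ps @ tl qs) = pl_length ps + pl_length qs"
  using assms
proof (induction ps rule: induct_list012)
  case 1
  then show ?case by (simp add: pl_path_def)
next
  case (2 p)
  then have "qs \<noteq> []" by (auto simp: pl_path_def)
  then show ?case using 2 by (cases qs) auto
next
  case (3 p p' ps)
  then show ?case by (auto simp: pl_path_Cons)
qed

section \<open>The path metric along geodesic lines\<close>

context tree_graph
begin

abbreviation X :: "('v \<Rightarrow> real) set" where "X \<equiv> realisation V E"
abbreviation D :: "('v \<Rightarrow> real) \<Rightarrow> ('v \<Rightarrow> real) \<Rightarrow> real" where "D \<equiv> path_metric V E"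

lemma cellsD:
  assumes "c \<in> cells V E"
  shows "finite c" "c \<subseteq> V"
  using assms tree unfolding cells_def simplicial_tree_def by auto

lemma realisationD:
  assumes "p \<in> X"
  shows "finite (supp p)" "supp p \<subseteq> V" "supp p \<in> cells V E" "(\<Sum>v\<in>supp p. p v) = 1" "p v \<ge> 0"
  using assms cellsD by (auto simp: realisation_def)

lemma sum_coordinates:
  assumes "p \<in> X" "finite S" "supp p \<subseteq> S"
  shows "(\<Sum>v\<in>S. p v) = 1"
proof -
  have "(\<Sum>v\<in>supp p. p v) = (\<Sum>v\<in>S. p v)"
    using assms by (intro sum.mono_neutral_left) (auto simp: supp_def)
  then show ?thesis using realisationD(4)[OF assms(1)] by simp
qed

lemma edge_point_in_realisation:
  assumes ab: "a = b \<and> a \<in> V \<or> {a, b} \<in> E" and t: "0 \<le> t" "t \<le> 1"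
  shows "edge_point a b t \<in> X"
proof -
  have V: "a \<in> V" "b \<in> V" using ab edgeD by auto
  have supp: "supp (edge_point a b t) =
      (if a = b then {a} else if t = 0 then {a} else if t = 1 then {b} else {a, b})"
    by (auto simp: supp_def edge_point_def)
  have "supp (edge_point a b t) \<in> cells V E"
    using ab V unfolding supp by (auto simp: cells_def)
  moreover have "(\<Sum>v\<in>supp (edge_point a b t). edge_point a b t v) = 1"
    unfolding supp by (auto simp: edge_point_def)
  moreover have "edge_point a b t v \<ge> 0" for v using t by (auto simp: edge_point_def)
  ultimately show ?thesis by (simp add: realisation_def)
qed

lemma vertex_point_in_realisation: "a \<in> V \<Longrightarrow> vertex_point a \<in> X"
  using edge_point_in_realisation[of a a 0] by (simp add: edge_point_0)

lemma line_point_in_realisation: "geodesic_line A \<Longrightarrow> line_point A t \<in> X"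
  unfolding line_point_def
  by (intro edge_point_in_realisation) (auto simp: geodesic_lineD frac_ge_0 less_imp_le[OF frac_lt_1])

lemma affine_extension_lipschitz:
  assumes pq: "p \<in> X" "q \<in> X" and c: "c \<in> cells V E" "supp p \<union> supp q \<subseteq> c"
    and f: "\<And>a b. {a, b} \<in> E \<Longrightarrow> \<bar>f a - f b\<bar> \<le> 1"
  shows "\<bar>affine_extension f p - affine_extension f q\<bar> \<le> cell_dist p q"
proof -
  have fin: "finite c" using cellsD c by blast
  have sp: "supp p \<subseteq> c" "supp q \<subseteq> c" using c by auto
  note F = affine_extension_superset[OF fin sp(1), of f] affine_extension_superset[OF fin sp(2), of f]
  note S = sum_coordinates[OF pq(1) fin sp(1)] sum_coordinates[OF pq(2) fin sp(2)]
  consider v where "c = {v}" | "c \<in> E" using c by (auto simp: cells_def)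
  then show ?thesis
  proof cases
    case 1
    then show ?thesis using F S by simp
  next
    case 2
    then obtain a b where ab: "a \<noteq> b" "c = {a, b}" using tree unfolding simplicial_tree_def by blast
    have S': "p b = 1 - p a" "q b = 1 - q a" using S ab by auto
    have "cell_dist p q = \<bar>p a - q a\<bar>"
      unfolding cell_dist_superset[OF fin sp] using ab S' by simp
    moreover have "affine_extension f p - affine_extension f q = (p a - q a) * of_int (f a - f b)"
      unfolding F using ab(1) by (simp add: ab(2) S' algebra_simps)
    moreover have "\<bar>f a - f b\<bar> \<le> 1" using f 2 ab by auto
    then have "\<bar>of_int (f a - f b) :: real\<bar> \<le> 1" by linarith
    ultimately show ?thesis
      by (simp add: abs_mult mult_left_le)
  qed
qed

lemma affine_extension_le_pl_length:
  assumes "pl_path V E ps" and f: "\<And>a b. {a, b} \<in> E \<Longrightarrow> \<bar>f a - f b\<bar> \<le> 1"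
  shows "\<bar>affine_extension f (hd ps) - affine_extension f (last ps)\<bar> \<le> pl_length ps"
  using assms(1)
proof (induction ps rule: induct_list012)
  case (3 p q ps)
  then obtain c where c: "c \<in> cells V E" "supp p \<union> supp q \<subseteq> c" "p \<in> X" "q \<in> X" "pl_path V E (q # ps)"
    by (auto simp: pl_path_Cons) (auto simp: pl_path_def)
  have "\<bar>affine_extension f p - affine_extension f q\<bar> \<le> cell_dist p q"
    using affine_extension_lipschitz[OF c(3,4,1,2) f] .
  then show ?case using 3 c by simp
qed (auto simp: pl_path_def)

text \<open>The infimum in \<open>path_metric\<close> must range over a nonempty set before a lower
  bound for path lengths can pass to it. From \<open>p\<close> the path goes to a vertex of its
  support, along a walk of the tree to a vertex of the support of \<open>q\<close>, and then to
  \<open>q\<close>.\<close>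

lemma ex_pl_path:
  assumes "p \<in> X" "q \<in> X"
  shows "\<exists>ps. pl_path V E ps \<and> hd ps = p \<and> last ps = q"
proof -
  have ex: "\<exists>v. v \<in> supp r \<and> v \<in> V" if "r \<in> X" for r
    using realisationD[OF that] by (metis all_not_in_conv subsetD sum.empty zero_neq_one)
  obtain u v where uv: "u \<in> supp p" "u \<in> V" "v \<in> supp q" "v \<in> V" using ex assms by metis
  have sv: "supp (vertex_point w) = {w}" for w :: 'v by (auto simp: supp_def vertex_point_def)
  obtain xs where xs: "walk V E xs" "hd xs = u" "last xs = v"
    using tree uv unfolding simplicial_tree_def by blast
  have ne: "xs \<noteq> []" using xs by (auto simp: walk_def)
  have w: "pl_path V E (map vertex_point xs)"
    unfolding pl_path_def successively_map
  proof (intro conjI)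
    show "set (map vertex_point xs) \<subseteq> X"
      using xs by (auto simp: walk_def intro!: vertex_point_in_realisation)
    have "successively (\<lambda>u v. {u, v} \<in> E) xs" using xs by (simp add: walk_def)
    then show "successively (\<lambda>x y. \<exists>c\<in>cells V E. supp (vertex_point x) \<union> supp (vertex_point y) \<subseteq> c) xs"
      by (rule successively_mono) (auto simp: sv cells_def)
  qed (use ne in auto)
  have a: "pl_path V E [p, vertex_point u]" "pl_path V E [vertex_point v, q]"
    using assms uv realisationD(3)[OF assms(1)] realisationD(3)[OF assms(2)]
    by (auto simp: pl_path_def sv vertex_point_in_realisation)
  let ?r = "[p, vertex_point u] @ tl (map vertex_point xs)"
  have r: "pl_path V E ?r" "hd ?r = p" "last ?r = vertex_point v"
    using pl_path_append[OF a(1) w] xs ne by (auto simp: hd_map last_map)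
  show ?thesis
    using pl_path_append[OF r(1) a(2)] r by (intro exI[of _ "?r @ tl [vertex_point v, q]"]) auto
qed

lemma D_le_pl_length:
  assumes "pl_path V E ps"
  shows "D (hd ps) (last ps) \<le> pl_length ps"
  unfolding path_metric_def
  by (rule cInf_lower) (use assms pl_length_nonneg in \<open>auto intro!: bdd_belowI[of _ 0]\<close>)

lemma D_geI:
  assumes "p \<in> X" "q \<in> X" "\<And>ps. pl_path V E ps \<Longrightarrow> hd ps = p \<Longrightarrow> last ps = q \<Longrightarrow> K \<le> pl_length ps"
  shows "K \<le> D p q"
  unfolding path_metric_def using ex_pl_path[OF assms(1,2)] assms(3)
  by (intro cInf_greatest) auto

lemma D_ge_affine_extension:
  assumes "p \<in> X" "q \<in> X" "\<And>a b. {a, b} \<in> E \<Longrightarrow> \<bar>f a - f b\<bar> \<le> 1"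
  shows "\<bar>affine_extension f p - affine_extension f q\<bar> \<le> D p q"
  using affine_extension_le_pl_length[of _ f] assms by (intro D_geI) auto

lemma D_triangle:
  assumes "p \<in> X" "q \<in> X" "r \<in> X"
  shows "D p r \<le> D p q + D q r"
proof -
  have "D p r - pl_length ps \<le> D q r" if ps: "pl_path V E ps" "hd ps = p" "last ps = q" for ps
  proof (rule D_geI)
    fix qs assume qs: "pl_path V E qs" "hd qs = q" "last qs = r"
    show "D p r - pl_length ps \<le> pl_length qs"
      using pl_path_append[OF ps(1) qs(1)] D_le_pl_length[of "ps @ tl qs"] ps qs by auto
  qed (use assms in auto)
  then have "D p r - D q r \<le> D p q" by (intro D_geI assms) (auto simp: algebra_simps)
  then show ?thesis by simp
qed

lemma D_edge_point:
  assumes "{a, b} \<in> E" "0 \<le> s" "s \<le> 1" "0 \<le> t" "t \<le> 1"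
  shows "D (edge_point a b s) (edge_point a b t) \<le> \<bar>s - t\<bar>"
proof -
  have "pl_path V E [edge_point a b s, edge_point a b t]"
    using assms supp_edge_point[of a b s] supp_edge_point[of a b t]
    by (auto simp: pl_path_def cells_def edge_point_in_realisation)
  then show ?thesis
    using D_le_pl_length cell_dist_edge_point[of a b s t] edgeD[OF assms(1)] by fastforce
qed

lemma D_vertex_point:
  assumes "u \<in> V" "v \<in> V"
  shows "D (vertex_point u) (vertex_point v) \<le> d u v"
  using assms
proof (induction "nat (d u v)" arbitrary: u)
  case 0
  then have "u = v" using d_eq_0 d_nonneg[of u v] by (metis nat_0_iff order_antisym)
  moreover have "pl_path V E [vertex_point u]" using 0 by (simp add: pl_path_def vertex_point_in_realisation)
  ultimately show ?case using D_le_pl_length[of "[vertex_point u]"] 0 by simp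
next
  case (Suc n)
  then have "u \<noteq> v" by auto
  then obtain w where w: "{u, w} \<in> E" "d w v = d u v - 1"
    using ex_closer_neighbour Suc.prems by metis
  have wV: "w \<in> V" using edgeD w by blast
  have "D (vertex_point w) (vertex_point v) \<le> d w v"
    using Suc w wV by (intro Suc.hyps(1)) auto
  moreover have "D (vertex_point u) (vertex_point w) \<le> 1"
    using D_edge_point[OF w(1), of 0 1] by (simp add: edge_point_0 edge_point_1)
  ultimately show ?case
    using D_triangle[of "vertex_point u" "vertex_point w" "vertex_point v"] w wV Suc.prems
    by (simp add: vertex_point_in_realisation)
qed

lemma D_line_point_cell:
  assumes A: "geodesic_line A" and "of_int k \<le> s" "s \<le> t" "t \<le> of_int k + 1"
  shows "D (line_point A s) (line_point A t) \<le> t - s"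
  using D_edge_point[OF geodesic_lineD(3)[OF A], of "s - of_int k" "t - of_int k" k] assms
  by (simp add: line_point_edge_point[of k])

lemma D_line_point_le:
  assumes A: "geodesic_line A" and "s \<le> t"
  shows "D (line_point A s) (line_point A t) \<le> t - s"
proof (cases "\<lfloor>s\<rfloor> = \<lfloor>t\<rfloor>")
  case True
  then show ?thesis using assms by (intro D_line_point_cell[OF A, of "\<lfloor>s\<rfloor>"]) linarith+
next
  case False
  let ?a = "of_int (\<lfloor>s\<rfloor> + 1) :: real" and ?b = "of_int \<lfloor>t\<rfloor> :: real"
  have le: "\<lfloor>s\<rfloor> + 1 \<le> \<lfloor>t\<rfloor>" using False floor_mono[OF \<open>s \<le> t\<close>] by linarith
  have "D (line_point A s) (line_point A ?a) \<le> ?a - s"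
    by (intro D_line_point_cell[OF A, of "\<lfloor>s\<rfloor>"]) linarith+
  moreover have "D (line_point A ?a) (line_point A ?b) \<le> ?b - ?a"
    using D_vertex_point[OF geodesic_lineD(1)[OF A] geodesic_lineD(1)[OF A], of "\<lfloor>s\<rfloor> + 1" "\<lfloor>t\<rfloor>"] le
    unfolding line_point_of_int by (simp add: geodesic_lineD[OF A])
  moreover have "D (line_point A ?b) (line_point A t) \<le> t - ?b"
    by (intro D_line_point_cell[OF A, of "\<lfloor>t\<rfloor>"]) linarith+
  moreover note D_triangle[of "line_point A s" "line_point A ?a" "line_point A t"]
    D_triangle[of "line_point A ?a" "line_point A ?b" "line_point A t"]
  ultimately show ?thesis using line_point_in_realisation[OF A] by simp
qed

text \<open>The distance from the vertex \<open>A \<lfloor>s\<rfloor>\<close> changes by 1 along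
  edges, and its affine extension grows at unit speed along the line from parameter \<open>s\<close>
  on. Stating both orders avoids an appeal to symmetry of \<open>D\<close>.\<close>

lemma D_line_point_ge:
  assumes A: "geodesic_line A" and "s \<le> t"
  shows "t - s \<le> D (line_point A s) (line_point A t)" "t - s \<le> D (line_point A t) (line_point A s)"
proof -
  define f where "f = d (A \<lfloor>s\<rfloor>)"
  have f1: "\<bar>f a - f b\<bar> \<le> 1" if "{a, b} \<in> E" for a b
    using d_edge_cases[OF geodesic_lineD(1)[OF A] that, of "\<lfloor>s\<rfloor>"] by (auto simp: f_def)
  have F: "affine_extension f (line_point A r) = r - of_int \<lfloor>s\<rfloor>" if "s \<le> r" for r
    using floor_mono[OF that] unfolding line_point_def affine_extension_edge_point f_def
    by (simp add: geodesic_lineD[OF A] frac_def algebra_simps)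
  show "t - s \<le> D (line_point A s) (line_point A t)" "t - s \<le> D (line_point A t) (line_point A s)"
    using D_ge_affine_extension[of "line_point A s" "line_point A t" f]
      D_ge_affine_extension[of "line_point A t" "line_point A s" f] f1 F[of s] F[of t] \<open>s \<le> t\<close>
      line_point_in_realisation[OF A] by force+
qed

lemma line_point_reverse: "line_point (\<lambda>i. A (- i)) (- t) = line_point A t"
proof -
  let ?k = "\<lfloor>t\<rfloor>"
  have "line_point A t = edge_point (A ?k) (A (?k + 1)) (t - ?k)"
    by (rule line_point_edge_point) linarith+
  moreover have "line_point (\<lambda>i. A (- i)) (- t) =
      edge_point (A (?k + 1)) (A ?k) (- t - of_int (- ?k - 1))"
    by (subst line_point_edge_point[of "- ?k - 1"]) (linarith | simp add: add.commute)+
  ultimately show ?thesis by (auto simp: edge_point_def algebra_simps)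
qed

lemma geodesic_line_point:
  assumes A: "geodesic_line A" and I: "is_interval I" "I \<noteq> {}"
  shows "geodesic X D I (line_point A)"
  unfolding geodesic_def
proof (intro conjI ballI)
  have *: "D (line_point A s) (line_point A t) = \<bar>s - t\<bar>" for s t
  proof (cases "s \<le> t")
    case True
    then show ?thesis using D_line_point_le[OF A True] D_line_point_ge[OF A True] by simp
  next
    case False
    then have "D (line_point A s) (line_point A t) \<le> s - t"
      using D_line_point_le[OF geodesic_line_reverse[OF A], of "- s" "- t"]
      by (simp add: line_point_reverse)
    then show ?thesis using D_line_point_ge(2)[OF A, of t s] False by simp
  qed
  show "D (line_point A s) (line_point A t) = \<bar>s - t\<bar>" for s t by (rule *)
qed (use I line_point_in_realisation[OF A] in auto)

end

section \<open>Actions on a tree and its boundary\<close>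

definition power_alternative_at :: "('g, 'm) monoid_scheme \<Rightarrow> 'g \<Rightarrow> 'g \<Rightarrow> bool" where
  "power_alternative_at G g h \<longleftrightarrow> (\<exists>n::nat. n \<ge> 1 \<and>
    (g [^]\<^bsub>G\<^esub> n \<otimes>\<^bsub>G\<^esub> h [^]\<^bsub>G\<^esub> n = h [^]\<^bsub>G\<^esub> n \<otimes>\<^bsub>G\<^esub> g [^]\<^bsub>G\<^esub> n \<or>
     G\<lparr>carrier := generate G {g [^]\<^bsub>G\<^esub> n, h [^]\<^bsub>G\<^esub> n}\<rparr> \<cong> F2))"

text \<open>If \<open>n\<close> works in \<open>H\<close> for \<open>g [^] N\<close> and
  \<open>h [^] N\<close>, then \<open>N * n\<close> works in \<open>G\<close> for \<open>g\<close>
  and \<open>h\<close>, since the generated subgroup is the same whether formed in \<open>H\<close>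
  or in \<open>G\<close>. This is how the hypotheses on stabilisers enter.\<close>

lemma (in group) power_alternative_at_subgroup:
  assumes H: "subgroup H G" "power_alternative (G\<lparr>carrier := H\<rparr>)"
    and gh: "g \<in> carrier G" "h \<in> carrier G" and N: "(N::nat) \<ge> 1" "g [^] N \<in> H" "h [^] N \<in> H"
  shows "power_alternative_at G g h"
proof -
  let ?H = "G\<lparr>carrier := H\<rparr>" and ?g = "g [^] N" and ?h = "h [^] N"
  obtain n :: nat where n: "n \<ge> 1"
    "?g [^] n \<otimes> ?h [^] n = ?h [^] n \<otimes> ?g [^] n \<or>
     ?H\<lparr>carrier := generate ?H {?g [^] n, ?h [^] n}\<rparr> \<cong> F2"
    using H(2) N unfolding power_alternative_def by (auto simp: nat_pow_consistent[symmetric])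
  interpret H: subgroup H G by (rule H)
  have "x [^] n \<in> H" if "x \<in> H" for x
    using that by (induction n) auto
  then have "?g [^] n \<in> H" "?h [^] n \<in> H" using N by auto
  then have "generate ?H {?g [^] n, ?h [^] n} = generate G {?g [^] n, ?h [^] n}"
    by (intro generate_consistent H) auto
  moreover have "?g [^] n = g [^] (N * n)" "?h [^] n = h [^] (N * n)"
    using gh by (simp_all add: nat_pow_pow)
  ultimately show ?thesis
    using n N unfolding power_alternative_at_def by (intro exI[of _ "N * n"]) auto
qed

locale tree_action = tree_graph V E + group_action G V \<phi>
  for V :: "'v set" and E :: "'v set set" and G :: "('g, 'm) monoid_scheme" (structure)
    and \<phi> :: "'g \<Rightarrow> 'v \<Rightarrow> 'v" +
  assumes automorphisms: "g \<in> carrier G \<Longrightarrow> graph_automorphism V E (\<phi> g)"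

sublocale tree_action \<subseteq> group G
  using group_hom by (rule group_hom.axioms)

section \<open>The induced action on the realisation\<close>

context tree_action
begin

abbreviation \<psi> :: "'g \<Rightarrow> ('v \<Rightarrow> real) \<Rightarrow> 'v \<Rightarrow> real" where "\<psi> \<equiv> realised_action V E \<phi>"

lemma action_inv_right: "g \<in> carrier G \<Longrightarrow> x \<in> V \<Longrightarrow> \<phi> g (\<phi> (inv g) x) = x"
  using action_inv_left[of "inv g" x] by simp

lemma action_inj: "g \<in> carrier G \<Longrightarrow> inj_on (\<phi> g) V"
  by (metis action_inv_left inj_onI)

lemma action_edge:
  assumes "g \<in> carrier G" "{u, v} \<in> E"
  shows "{\<phi> g u, \<phi> g v} \<in> E"
  using automorphisms[OF assms(1)] edgeD[OF assms(2)] assms(2) unfolding graph_automorphism_def by blast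

lemma action_cell:
  assumes g: "g \<in> carrier G" and c: "c \<in> cells V E"
  shows "\<phi> g ` c \<in> cells V E"
proof -
  consider v where "c = {v}" "v \<in> V" | "c \<in> E" using c by (auto simp: cells_def)
  then show ?thesis
  proof cases
    case 2
    then obtain a b where "c = {a, b}" using tree unfolding simplicial_tree_def by blast
    then show ?thesis using action_edge[OF g] 2 by (auto simp: cells_def)
  qed (use action_closed[OF g] in \<open>auto simp: cells_def\<close>)
qed

lemma d_action:
  assumes g: "g \<in> carrier G" and uv: "u \<in> V" "v \<in> V"
  shows "d (\<phi> g u) (\<phi> g v) = d u v"
proof (rule order_antisym)
  have le: "d (\<phi> g u) (\<phi> g v) \<le> d u v" if g: "g \<in> carrier G" and uv: "u \<in> V" "v \<in> V" for g u v
  proof -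
    obtain xs where xs: "walk V E xs" "hd xs = u" "last xs = v" "int (length xs) = d u v + 1"
      using ex_shortest_walk uv by blast
    have "successively (\<lambda>u v. {\<phi> g u, \<phi> g v} \<in> E) xs"
      using xs unfolding walk_def by (metis (mono_tags, lifting) successively_mono action_edge g)
    then have "walk V E (map (\<phi> g) xs)"
      using xs action_closed[OF g] unfolding walk_def successively_map by auto
    then show ?thesis using d_le_walk[of "map (\<phi> g) xs"] xs by (auto simp: walk_def hd_map last_map)
  qed
  show "d (\<phi> g u) (\<phi> g v) \<le> d u v" using le assms by blast
  show "d u v \<le> d (\<phi> g u) (\<phi> g v)"
    using le[of "inv g" "\<phi> g u" "\<phi> g v"] assms by (simp add: action_closed action_inv_left)
qed

text \<open>\<open>\<phi> g\<close> is injective on \<open>V\<close>, so the sum defining the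
  push-forward has at most one term: acting on points is precomposition with the inverse. Outside
  \<open>V\<close> all coordinates vanish.\<close>

lemma realised_action_eq:
  assumes g: "g \<in> carrier G" and p: "p \<in> X"
  shows "\<psi> g p = (\<lambda>w. if w \<in> V then p (\<phi> (inv g) w) else 0)"
proof
  fix w
  have V: "supp p \<subseteq> V" using realisationD p by blast
  have "\<psi> g p w = (\<Sum>v\<in>{v \<in> supp p. \<phi> g v = w}. p v)" using p by (simp add: realised_action_def)
  also have "\<dots> = (if w \<in> V then p (\<phi> (inv g) w) else 0)"
  proof (cases "w \<in> V \<and> \<phi> (inv g) w \<in> supp p")
    case True
    then have "{v \<in> supp p. \<phi> g v = w} = {\<phi> (inv g) w}"
      using V g action_inv_left action_inv_right by auto
    then show ?thesis using True by simp
  next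
    case False
    then have "\<phi> g v \<noteq> w" if "v \<in> supp p" for v
      using that V action_inv_left[OF g, of v] action_closed[OF g, of v] by auto
    then have "{v \<in> supp p. \<phi> g v = w} = {}" by auto
    then have "(\<Sum>v\<in>{v \<in> supp p. \<phi> g v = w}. p v) = 0" by (simp only: sum.empty)
    then show ?thesis using False by (auto simp: supp_def)
  qed
  finally show "\<psi> g p w = (if w \<in> V then p (\<phi> (inv g) w) else 0)" .
qed

lemma realised_action_apply:
  "g \<in> carrier G \<Longrightarrow> p \<in> X \<Longrightarrow> v \<in> V \<Longrightarrow> \<psi> g p (\<phi> g v) = p v"
  by (simp add: realised_action_eq action_closed action_inv_left)

lemma supp_realised_action:
  assumes g: "g \<in> carrier G" and p: "p \<in> X"
  shows "supp (\<psi> g p) = \<phi> g ` supp p"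
proof -
  have V: "supp p \<subseteq> V" using realisationD p by blast
  show ?thesis
  proof
    show "supp (\<psi> g p) \<subseteq> \<phi> g ` supp p"
      using action_inv_right[OF g] unfolding realised_action_eq[OF g p] supp_def
      by (auto split: if_splits) (metis (mono_tags, lifting) image_eqI mem_Collect_eq)
    show "\<phi> g ` supp p \<subseteq> supp (\<psi> g p)"
      using V realised_action_apply[OF g p] by (auto simp: supp_def)
  qed
qed

lemma realised_action_closed:
  assumes g: "g \<in> carrier G" and p: "p \<in> X"
  shows "\<psi> g p \<in> X"
proof -
  note R = realisationD[OF p]
  have inj: "inj_on (\<phi> g) (supp p)" using action_inj[OF g] R(2) by (rule inj_on_subset)
  have "(\<Sum>v\<in>supp (\<psi> g p). \<psi> g p v) = (\<Sum>v\<in>supp p. p v)"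
    unfolding supp_realised_action[OF g p] sum.reindex[OF inj] o_def
    using R(2) realised_action_apply[OF g p] by (intro sum.cong) auto
  moreover have "\<psi> g p v \<ge> 0" for v using R(5) by (simp add: realised_action_eq[OF g p])
  ultimately show ?thesis
    using action_cell[OF g R(3)] R(4) by (simp add: realisation_def supp_realised_action[OF g p])
qed

lemma realised_action_mult:
  assumes "g \<in> carrier G" "h \<in> carrier G" "p \<in> X"
  shows "\<psi> (g \<otimes> h) p = \<psi> g (\<psi> h p)"
proof
  fix w
  have "\<psi> g (\<psi> h p) w = (if w \<in> V then \<psi> h p (\<phi> (inv g) w) else 0)"
    by (simp only: realised_action_eq[OF assms(1) realised_action_closed[OF assms(2,3)]])
  then show "\<psi> (g \<otimes> h) p w = \<psi> g (\<psi> h p) w"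
    using assms by (simp add: realised_action_eq inv_mult_group action_mult action_closed)
qed

lemma realised_action_one: "p \<in> X \<Longrightarrow> \<psi> \<one> p = p"
  using realisationD(2)[of p] by (auto simp: fun_eq_iff realised_action_eq action_one supp_def)

lemma realised_action_inv: "g \<in> carrier G \<Longrightarrow> p \<in> X \<Longrightarrow> \<psi> (inv g) (\<psi> g p) = p"
  using realised_action_mult[of "inv g" g p] by (simp add: realised_action_one)

lemma realised_action_edge_point:
  assumes g: "g \<in> carrier G" and "edge_point a b t \<in> X" and "a \<in> V" "b \<in> V"
  shows "\<psi> g (edge_point a b t) = edge_point (\<phi> g a) (\<phi> g b) t"
proof -
  have "\<phi> (inv g) w = c \<longleftrightarrow> w = \<phi> g c" if "w \<in> V" "c \<in> V" for w c
    using that g action_inv_left action_inv_right by metis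
  then show ?thesis
    unfolding realised_action_eq[OF g assms(2)]
    using assms action_closed[OF g] by (auto simp: fun_eq_iff edge_point_def)
qed

lemma realised_action_vertex_point:
  "g \<in> carrier G \<Longrightarrow> a \<in> V \<Longrightarrow> \<psi> g (vertex_point a) = vertex_point (\<phi> g a)"
  using realised_action_edge_point[of g a a 0] vertex_point_in_realisation[of a]
  by (simp add: edge_point_0)

lemma cell_dist_realised_action:
  assumes g: "g \<in> carrier G" and pq: "p \<in> X" "q \<in> X"
  shows "cell_dist (\<psi> g p) (\<psi> g q) = cell_dist p q"
proof -
  let ?S = "supp p \<union> supp q"
  have V: "?S \<subseteq> V" using realisationD pq by blast
  have inj: "inj_on (\<phi> g) ?S" using action_inj[OF g] V by (rule inj_on_subset)
  have "(\<Sum>v\<in>\<phi> g ` ?S. \<bar>\<psi> g p v - \<psi> g q v\<bar>) = (\<Sum>v\<in>?S. \<bar>p v - q v\<bar>)"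
    unfolding sum.reindex[OF inj] o_def
    using V realised_action_apply[OF g] pq by (intro sum.cong) auto
  then show ?thesis
    by (simp add: cell_dist_def supp_realised_action[OF g] pq image_Un)
qed

lemma D_realised_action:
  assumes g: "g \<in> carrier G" and pq: "p \<in> X" "q \<in> X"
  shows "D (\<psi> g p) (\<psi> g q) = D p q"
proof (rule order_antisym)
  have le: "D (\<psi> g p) (\<psi> g q) \<le> D p q" if g: "g \<in> carrier G" and pq: "p \<in> X" "q \<in> X" for g p q
  proof (rule D_geI[OF pq])
    fix ps assume ps: "pl_path V E ps" "hd ps = p" "last ps = q"
    have "pl_path V E (map (\<psi> g) ps) \<and> pl_length (map (\<psi> g) ps) = pl_length ps"
      using ps(1)
    proof (induction ps rule: induct_list012)
      case (3 p q ps)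
      then have pq: "p \<in> X" "q \<in> X" "pl_path V E (q # ps)" by (auto simp: pl_path_def)
      obtain c where c: "c \<in> cells V E" "supp p \<union> supp q \<subseteq> c" using 3 by (auto simp: pl_path_Cons)
      have "\<phi> g ` c \<in> cells V E" "supp (\<psi> g p) \<union> supp (\<psi> g q) \<subseteq> \<phi> g ` c"
        using action_cell[OF g c(1)] c(2) pq by (auto simp: supp_realised_action[OF g])
      then show ?case
        using 3 pq cell_dist_realised_action[OF g] realised_action_closed[OF g]
        by (auto simp: pl_path_Cons)
    qed (use realised_action_closed[OF g] in \<open>auto simp: pl_path_def\<close>)
    moreover have "ps \<noteq> []" using ps by (auto simp: pl_path_def)
    ultimately show "D (\<psi> g p) (\<psi> g q) \<le> pl_length ps"
      using D_le_pl_length[of "map (\<psi> g) ps"] ps by (auto simp: hd_map last_map)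
  qed
  show "D (\<psi> g p) (\<psi> g q) \<le> D p q" using le assms by blast
  show "D p q \<le> D (\<psi> g p) (\<psi> g q)"
    using le[of "inv g" "\<psi> g p" "\<psi> g q"] assms
    by (simp add: realised_action_closed realised_action_inv)
qed

lemma realised_action_line_point:
  assumes g: "g \<in> carrier G" and A: "geodesic_line A"
  shows "\<psi> g (line_point A t) = line_point (\<lambda>i. \<phi> g (A i)) t"
  unfolding line_point_def using line_point_in_realisation[OF A, of t]
  by (intro realised_action_edge_point g geodesic_lineD(1)[OF A]) (simp add: line_point_def)

text \<open>Passes from stabilisers in the realisation to vertices: an edge with both ends fixed is
  fixed pointwise. With integer bounds, every non-integer parameter of the segment lies on an edge
  with both ends in the segment.\<close>

lemma pointwise_stabilizer_line:
  assumes A: "geodesic_line A"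
  shows "pointwise_stabilizer G \<psi> (line_point A ` {of_int a..of_int b}) =
    {u \<in> carrier G. \<forall>j\<in>{a..b}. \<phi> u (A j) = A j}"
proof -
  have "(\<forall>t\<in>{of_int a..of_int b}. \<psi> u (line_point A t) = line_point A t) \<longleftrightarrow>
      (\<forall>j\<in>{a..b}. \<phi> u (A j) = A j)" if u: "u \<in> carrier G" for u
  proof safe
    fix j assume "\<forall>t\<in>{of_int a..of_int b}. \<psi> u (line_point A t) = line_point A t" "j \<in> {a..b}"
    then have "\<psi> u (line_point A (of_int j)) = line_point A (of_int j)" by simp
    then show "\<phi> u (A j) = A j"
      by (simp add: line_point_of_int realised_action_vertex_point[OF u] geodesic_lineD[OF A]
          vertex_point_eq_iff)
  next
    fix t :: real assume fixed: "\<forall>j\<in>{a..b}. \<phi> u (A j) = A j" and t: "t \<in> {of_int a..of_int b}"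
    have k: "\<lfloor>t\<rfloor> \<in> {a..b}" using t by (auto simp: le_floor_iff floor_le_iff)
    show "\<psi> u (line_point A t) = line_point A t"
    proof (cases "t = of_int \<lfloor>t\<rfloor>")
      case True
      then have "line_point A t = vertex_point (A \<lfloor>t\<rfloor>)" using line_point_of_int by metis
      then show ?thesis
        using fixed k by (simp add: realised_action_vertex_point[OF u] geodesic_lineD[OF A])
    next
      case False
      then have "\<lfloor>t\<rfloor> + 1 \<in> {a..b}" using t k by (auto simp: less_le) linarith
      then show ?thesis
        unfolding realised_action_line_point[OF u A] using fixed k by (simp add: line_point_def)
    qed
  qed
  then show ?thesis unfolding pointwise_stabilizer_def by auto
qed

text \<open>An element fixing \<open>A i\<close> and \<open>A j\<close> preserves the distances of
  \<open>A k\<close> to both, and the point between them with these distances is unique.\<close>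

lemma fixes_between:
  assumes A: "geodesic_line A" and u: "u \<in> carrier G"
    and ij: "\<phi> u (A i) = A i" "\<phi> u (A j) = A j" and k: "i \<le> k" "k \<le> j"
  shows "\<phi> u (A k) = A k"
proof (rule geodesic_point_unique[of "A i" "A j"])
  note [simp] = geodesic_lineD[OF A] action_closed[OF u]
  have "d (A i) (\<phi> u (A k)) = d (A i) (A k)" "d (\<phi> u (A k)) (A j) = d (A k) (A j)"
    using d_action[OF u, of "A i" "A k"] d_action[OF u, of "A k" "A j"] ij by auto
  then show "d (A i) (\<phi> u (A k)) + d (\<phi> u (A k)) (A j) = d (A i) (A j)"
    "d (A i) (\<phi> u (A k)) = d (A i) (A k)" using k by auto
qed (use k in \<open>auto simp: geodesic_lineD[OF A] action_closed[OF u]\<close>)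

section \<open>Axes and the stabilisation property\<close>

definition axis :: "'g \<Rightarrow> (int \<Rightarrow> 'v) \<Rightarrow> int \<Rightarrow> bool" where
  "axis g A L \<longleftrightarrow> L > 0 \<and> geodesic_line A \<and> (\<forall>i. \<phi> g (A i) = A (i + L))"

lemma axis_pow:
  assumes g: "g \<in> carrier G" and A: "axis g A L"
  shows "\<phi> (g [^] (k::int)) (A i) = A (i + k * L)"
proof -
  have AV: "A i \<in> V" for i using A geodesic_lineD by (auto simp: axis_def)
  have nat: "\<phi> (g [^] n) (A i) = A (i + int n * L)" for n :: nat and i
  proof (induction n arbitrary: i)
    case (Suc n)
    have "\<phi> (g [^] Suc n) (A i) = \<phi> (g [^] n) (\<phi> g (A i))" using g AV by (simp add: action_mult)
    then show ?case using Suc A by (simp add: axis_def algebra_simps)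
  qed (simp add: action_one AV)
  show ?thesis
  proof (cases "k \<ge> 0")
    case True
    then show ?thesis using nat[of "nat k" i] int_pow_int[of G g "nat k"] by simp
  next
    case False
    define n where "n = nat (- k)"
    have "g [^] k = inv (g [^] n)" using False g int_pow_neg_int[of g n] by (simp add: n_def)
    moreover have "\<phi> (g [^] n) (A (i + k * L)) = A i" using nat[of n "i + k * L"] False by (simp add: n_def)
    ultimately show ?thesis using action_inv_left[of "g [^] n" "A (i + k * L)"] g AV by simp
  qed
qed

text \<open>The pointwise stabilisers of the segments of length \<open>2 n L\<close> centred at \<open>A 0\<close> stabilise, and
  translating along the axis carries this to every other centre.\<close>

lemma fixes_long_segment_imp_fixes_axis:
  assumes stab: "stabilisation_property G X D \<psi>" and g: "g \<in> carrier G" and ax: "axis g A L"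
  shows "\<exists>M\<ge>0. \<forall>u\<in>carrier G. \<forall>i. \<phi> u (A i) = A i \<and> \<phi> u (A (i + M)) = A (i + M) \<longrightarrow>
    (\<forall>j. \<phi> u (A j) = A j)"
proof -
  have A: "geodesic_line A" and L: "L > 0" using ax by (auto simp: axis_def)
  note AV = geodesic_lineD(1)[OF A]
  define I where "I n = {of_int (- (int n * L))..of_int (int n * L) :: real}" for n
  define H where "H n = {u \<in> carrier G. \<forall>j\<in>{- (int n * L)..int n * L}. \<phi> u (A j) = A j}" for n
  have geo: "geodesic X D (I n) (line_point A)" for n
    using L by (intro geodesic_line_point A) (auto simp: I_def is_interval_cc)
  have "int n * L \<le> int (Suc n) * L" for n using L by simp
  then have "of_int (int n * L) \<le> (of_int (int (Suc n) * L) :: real)" for n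
    by (simp only: of_int_le_iff)
  then have sub: "I n \<subseteq> I (Suc n)" for n
    unfolding I_def atLeastatMost_subset_iff of_int_minus neg_le_iff_le by blast
  have "emeasure lborel (I n) = ennreal (real n * (2 * of_int L))" for n
    using L unfolding I_def by (subst emeasure_lborel_Icc) (auto simp: algebra_simps)
  moreover have "(\<lambda>n. ennreal (real n * (2 * of_int L))) \<longlonglongrightarrow> \<infinity>"
  proof -
    have "filterlim (\<lambda>n. real n * (2 * of_int L)) at_top sequentially"
      using L by (intro filterlim_at_top_mult_tendsto_pos[OF tendsto_const _ filterlim_real_sequentially]) auto
    then show ?thesis
      by (simp add: ennreal_tendsto_top_eq_at_top)
  qed
  ultimately have "(\<lambda>n. emeasure lborel (I n)) \<longlonglongrightarrow> \<infinity>" by simp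
  then obtain N where N: "\<forall>n\<ge>N. pointwise_stabilizer G \<psi> (line_point A ` I n)
      = pointwise_stabilizer G \<psi> (line_point A ` I (Suc n))"
    using stab[unfolded stabilisation_property_def, rule_format, of I "\<lambda>_. line_point A"]
      geo sub image_mono by metis
  then have HS: "H n = H (Suc n)" if "n \<ge> N" for n
    using that unfolding I_def H_def pointwise_stabilizer_line[OF A] by blast
  have HN: "H n = H N" if "n \<ge> N" for n
    using that
  proof (induction n rule: dec_induct)
    case (step n)
    show ?case using HS[OF step.hyps(1)] step.IH by (rule trans[OF sym])
  qed simp
  \<comment> \<open>\<open>H N\<close> equals every later \<open>H n\<close>, and since
    \<open>L \<ge> 1\<close> the segments belonging to these exhaust the line.\<close>
  have all: "\<phi> u (A j) = A j" if "u \<in> H N" for u j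
  proof -
    define n where "n = max N (nat \<bar>j\<bar>)"
    have "u \<in> H n" using that HN[of n] by (simp add: n_def)
    moreover have "int n * 1 \<le> int n * L" using L by (intro mult_left_mono) auto
    moreover have "\<bar>j\<bar> \<le> int n" by (simp add: n_def)
    ultimately have "j \<in> {- (int n * L)..int n * L}" by auto
    then show ?thesis using \<open>u \<in> H n\<close> unfolding H_def by blast
  qed
  \<comment> \<open>Any stretch of length \<open>(2 * N + 1) * L\<close> contains one of length
    \<open>2 * N * L\<close> centred at a multiple of \<open>L\<close>; for the stretch starting at
    index \<open>i\<close>, the centre \<open>k * L\<close> with \<open>k = i div L + 1 + N\<close>
    works.\<close>
  define M where "M = (2 * int N + 1) * L"
  have "\<phi> u (A j) = A j"
    if u: "u \<in> carrier G" and fixed: "\<phi> u (A i) = A i" "\<phi> u (A (i + M)) = A (i + M)" for u i j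
  proof -
    define k where "k = i div L + 1 + int N"
    define c where "c = g [^] k"
    have c: "c \<in> carrier G" using g by (simp add: c_def)
    have cA: "\<phi> c (A j) = A (j + k * L)" for j unfolding c_def by (rule axis_pow[OF g ax])
    have icA: "\<phi> (inv c) (A (j + k * L)) = A j" for j
      using action_inv_left[OF c AV, of j] unfolding cA .
    have iL: "i div L * L \<le> i" "i \<le> i div L * L + L"
      using div_mult_mod_eq[of i L] pos_mod_bound[OF L, of i] pos_mod_sign[OF L, of i] by linarith+
    define u' where "u' = inv c \<otimes> u \<otimes> c"
    have u'A: "\<phi> u' (A j) = \<phi> (inv c) (\<phi> u (A (j + k * L)))" for j
      using c u AV by (simp add: u'_def action_mult cA)
    have "\<phi> u' (A j) = A j" if j: "j \<in> {- (int N * L)..int N * L}" for j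
    proof -
      have "i \<le> j + k * L" "j + k * L \<le> i + M"
        using j iL by (auto simp: k_def M_def algebra_simps)
      then have "\<phi> u (A (j + k * L)) = A (j + k * L)" by (intro fixes_between[OF A u fixed])
      then show ?thesis using u'A icA by simp
    qed
    then have "u' \<in> H N" using c u by (simp add: H_def u'_def)
    then have "\<phi> u' (A (j - k * L)) = A (j - k * L)" by (rule all)
    then have "\<phi> c (\<phi> (inv c) (\<phi> u (A j))) = \<phi> c (A (j - k * L))" using u'A[of "j - k * L"] by simp
    then show ?thesis using action_inv_right[OF c, of "\<phi> u (A j)"] u AV by (simp add: cA action_closed)
  qed
  moreover have "M \<ge> 0" using L by (simp add: M_def)
  ultimately show ?thesis by blast
qed

section \<open>The action on the boundary\<close>

lemma boundary_action_one:
  assumes "\<xi> \<subseteq> geodesic_rays X D"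
  shows "boundary_action \<psi> \<one> \<xi> = \<xi>"
proof -
  have "compose {0..} (\<psi> \<one>) r = r" if "r \<in> \<xi>" for r
  proof -
    have r: "r \<in> extensional {0..}" "\<And>t. t \<ge> 0 \<Longrightarrow> r t \<in> X"
      using that assms by (auto simp: geodesic_rays_def geodesic_def)
    show ?thesis unfolding compose_def
      by (rule extensionalityI[OF _ r(1)]) (auto simp: realised_action_one r)
  qed
  then show ?thesis unfolding boundary_action_def by simp
qed

lemma boundary_action_mult:
  assumes "\<xi> \<subseteq> geodesic_rays X D" "g \<in> carrier G" "h \<in> carrier G"
  shows "boundary_action \<psi> (g \<otimes> h) \<xi> = boundary_action \<psi> g (boundary_action \<psi> h \<xi>)"
proof -
  have "compose {0..} (\<psi> (g \<otimes> h)) r = compose {0..} (\<psi> g) (compose {0..} (\<psi> h) r)"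
    if "r \<in> \<xi>" for r
  proof -
    have "r t \<in> X" if "t \<ge> 0" for t
      using that \<open>r \<in> \<xi>\<close> assms(1) by (auto simp: geodesic_rays_def geodesic_def)
    then show ?thesis unfolding compose_def
      using realised_action_mult[OF assms(2,3)] by (intro restrict_ext) simp
  qed
  then show ?thesis unfolding boundary_action_def image_image by (intro image_cong) auto
qed

lemma subgroup_boundary_stabilizer:
  assumes \<xi>: "\<xi> \<subseteq> geodesic_rays X D"
  shows "subgroup (stabilizer G (boundary_action \<psi>) \<xi>) G"
proof (rule subgroupI)
  fix g assume "g \<in> stabilizer G (boundary_action \<psi>) \<xi>"
  then show "inv g \<in> stabilizer G (boundary_action \<psi>) \<xi>"
    using boundary_action_mult[OF \<xi>, of "inv g" g] boundary_action_one[OF \<xi>]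
    by (simp add: stabilizer_def)
qed (use boundary_action_mult[OF \<xi>] boundary_action_one[OF \<xi>] in \<open>auto simp: stabilizer_def\<close>)

text \<open>A sufficient criterion, in terms of vertices, for \<open>u\<close> to fix the end of the
  half of \<open>A\<close> with nonnegative indices.\<close>

definition bounded_displacement :: "'g \<Rightarrow> (int \<Rightarrow> 'v) \<Rightarrow> bool" where
  "bounded_displacement u A \<longleftrightarrow> (\<exists>K. \<forall>i\<ge>0. d (A i) (\<phi> u (A i)) \<le> K)"

lemma bounded_displacement_inv:
  assumes u: "u \<in> carrier G" and A: "geodesic_line A" and b: "bounded_displacement u A"
  shows "bounded_displacement (inv u) A"
proof -
  have "d (A i) (\<phi> (inv u) (A i)) = d (A i) (\<phi> u (A i))" for i
  proof -
    have "d (A i) (\<phi> (inv u) (A i)) = d (\<phi> u (A i)) (\<phi> u (\<phi> (inv u) (A i)))"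
      using d_action[OF u] u geodesic_lineD(1)[OF A] by (simp add: action_closed)
    also have "\<dots> = d (\<phi> u (A i)) (A i)" using u geodesic_lineD(1)[OF A] by (simp add: action_inv_right)
    finally show ?thesis using d_commute u geodesic_lineD(1)[OF A] by (simp add: action_closed)
  qed
  then show ?thesis using b unfolding bounded_displacement_def by simp
qed

lemma compose_ray:
  assumes u: "u \<in> carrier G" and r: "r \<in> geodesic_rays X D"
  shows "compose {0..} (\<psi> u) r \<in> geodesic_rays X D"
  using r realised_action_closed[OF u] D_realised_action[OF u]
  by (auto simp: geodesic_rays_def geodesic_def compose_def image_subset_iff)

text \<open>The bound \<open>2 + K + K'\<close> adds up a detour: from \<open>line_point A t\<close>
  to the vertex at \<open>\<lfloor>t\<rfloor>\<close>, to its image under \<open>u\<close>, to the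
  image of \<open>line_point A t\<close>, and on to the image of \<open>s t\<close>.\<close>

lemma bounded_displacement_compose:
  assumes u: "u \<in> carrier G" and A: "geodesic_line A" and b: "bounded_displacement u A"
    and s: "(restrict (line_point A) {0..}, s) \<in> asymptotic X D"
  shows "(restrict (line_point A) {0..}, compose {0..} (\<psi> u) s) \<in> asymptotic X D"
proof -
  obtain K where K: "\<And>i. i \<ge> 0 \<Longrightarrow> d (A i) (\<phi> u (A i)) \<le> K"
    using b unfolding bounded_displacement_def by blast
  obtain K' where K': "\<And>t. t \<ge> 0 \<Longrightarrow> D (line_point A t) (s t) \<le> K'"
    using s unfolding asymptotic_def by auto
  have rays: "restrict (line_point A) {0..} \<in> geodesic_rays X D" "s \<in> geodesic_rays X D"
    using s by (auto simp: asymptotic_def)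
  have sX: "s t \<in> X" if "t \<ge> 0" for t
    using rays(2) that by (auto simp: geodesic_rays_def geodesic_def)
  have Dl: "D (line_point A t) (line_point A t') = \<bar>t - t'\<bar>" for t t'
    using geodesic_line_point[OF A, of UNIV] by (simp add: geodesic_def)
  note LX = line_point_in_realisation[OF A]
  have "D (line_point A t) (\<psi> u (s t)) \<le> 2 + of_int K + K'" if t: "t \<ge> 0" for t
  proof -
    let ?k = "\<lfloor>t\<rfloor>"
    let ?p = "line_point A t" and ?q = "line_point A (of_int ?k)"
    have k: "?k \<ge> 0" "\<bar>t - of_int ?k\<bar> \<le> 1" "\<bar>of_int ?k - t\<bar> \<le> 1" using t by (auto, linarith+)
    have "D ?q (\<psi> u ?q) \<le> d (A ?k) (\<phi> u (A ?k))"
      using D_vertex_point[of "A ?k" "\<phi> u (A ?k)"] u geodesic_lineD(1)[OF A]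
      by (simp add: line_point_of_int realised_action_vertex_point action_closed)
    also have "\<dots> \<le> of_int K" using K[OF k(1)] by simp
    finally have 1: "D ?q (\<psi> u ?q) \<le> of_int K" .
    have 2: "D ?p ?q \<le> 1" "D (\<psi> u ?q) (\<psi> u ?p) \<le> 1"
      using k by (auto simp: D_realised_action[OF u] LX Dl)
    have 3: "D (\<psi> u ?p) (\<psi> u (s t)) \<le> K'" using K'[OF t] by (simp add: D_realised_action[OF u] LX sX t)
    have "D ?p (\<psi> u (s t)) \<le> D ?p ?q + D ?q (\<psi> u (s t))"
      "D ?q (\<psi> u (s t)) \<le> D ?q (\<psi> u ?q) + D (\<psi> u ?q) (\<psi> u (s t))"
      "D (\<psi> u ?q) (\<psi> u (s t)) \<le> D (\<psi> u ?q) (\<psi> u ?p) + D (\<psi> u ?p) (\<psi> u (s t))"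
      using u LX sX[OF t] realised_action_closed by (auto intro!: D_triangle)
    then show ?thesis using 1 2 3 by linarith
  qed
  then show ?thesis
    using rays compose_ray[OF u rays(2)] unfolding asymptotic_def by (auto simp: compose_def)
qed

text \<open>Both powers fix the end of \<open>A\<close> in the direction of increasing indices, so
  they lie in the stabiliser of one boundary point, to which the hypothesis applies.\<close>

lemma end_alternative:
  assumes boundary: "\<forall>\<xi>\<in>gromov_boundary X D.
      power_alternative (G\<lparr>carrier := stabilizer G (boundary_action \<psi>) \<xi>\<rparr>)"
    and A: "geodesic_line A" and gh: "g \<in> carrier G" "h \<in> carrier G" and N: "(N::nat) \<ge> 1"
    and b: "bounded_displacement (g [^] N) A" "bounded_displacement (h [^] N) A"
  shows "power_alternative_at G g h"
proof -
  let ?r = "restrict (line_point A) {0..}"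
  let ?\<xi> = "asymptotic X D `` {?r}"
  have "geodesic X D {0..} (line_point A)"
    by (intro geodesic_line_point A) (auto simp: is_interval_ci)
  then have r: "?r \<in> geodesic_rays X D"
    by (auto simp: geodesic_rays_def geodesic_def)
  then have \<xi>: "?\<xi> \<in> gromov_boundary X D" unfolding gromov_boundary_def by (rule quotientI)
  have \<xi>_rays: "?\<xi> \<subseteq> geodesic_rays X D" by (auto simp: asymptotic_def)
  have sub: "boundary_action \<psi> u ?\<xi> \<subseteq> ?\<xi>" if "u \<in> carrier G" "bounded_displacement u A" for u
    using bounded_displacement_compose[OF that(1) A that(2)] by (auto simp: boundary_action_def)
  \<comment> \<open>Bounded displacement gives only that the class is mapped into itself. Equality
    follows from the same inclusion for \<open>inv u\<close>, whose displacements are equally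
    bounded.\<close>
  have st: "u \<in> stabilizer G (boundary_action \<psi>) ?\<xi>" if u: "u \<in> carrier G" "bounded_displacement u A" for u
  proof -
    have "boundary_action \<psi> (inv u) ?\<xi> \<subseteq> ?\<xi>"
      using sub[of "inv u"] u bounded_displacement_inv[OF u(1) A u(2)] by simp
    then have "boundary_action \<psi> u (boundary_action \<psi> (inv u) ?\<xi>) \<subseteq> boundary_action \<psi> u ?\<xi>"
      unfolding boundary_action_def[of _ u] by (rule image_mono)
    then have "?\<xi> \<subseteq> boundary_action \<psi> u ?\<xi>"
      using boundary_action_mult[OF \<xi>_rays u(1), of "inv u"] boundary_action_one[OF \<xi>_rays] u by simp
    then show ?thesis using sub[OF u] u by (auto simp: stabilizer_def)
  qed
  show ?thesis
    using gh b by (intro power_alternative_at_subgroup[OF subgroup_boundary_stabilizer[OF \<xi>_rays]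
      boundary[rule_format, OF \<xi>] gh N] st) auto
qed

end

section \<open>The power alternative\<close>

context tree_action
begin

section \<open>Elliptic elements\<close>

lemma fixes_int_pow:
  assumes u: "u \<in> carrier G" and x: "x \<in> V" "\<phi> u x = x"
  shows "\<phi> (u [^] (k::int)) x = x"
proof -
  have n: "\<phi> (u [^] n) x = x" for n :: nat
    using u x by (induction n) (auto simp: action_one action_mult)
  show ?thesis
  proof (cases k rule: int_cases2)
    case (nonneg n)
    then show ?thesis using n by (simp add: int_pow_int)
  next
    case (nonpos n)
    then show ?thesis
      using n[of n] action_inv_left[of "u [^] n" x] u x by (simp add: int_pow_neg_int)
  qed
qed

text \<open>Raising to the power \<open>sgn k\<close> makes the exponent nonnegative. Ping-pong
  speaks of integer exponents, while stabilisers are entered with natural ones.\<close>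

lemma fixes_nat_pow_abs:
  assumes u: "u \<in> carrier G" and x: "x \<in> V" "\<phi> (u [^] (int q * k)) x = x"
  shows "\<phi> (u [^] (q * nat \<bar>k\<bar>)) x = x"
proof -
  have "\<phi> ((u [^] (int q * k)) [^] (sgn k)) x = x" by (rule fixes_int_pow[OF int_pow_closed[OF u] x])
  moreover have "k * sgn k = \<bar>k\<bar>" by (simp add: abs_sgn)
  then have "int q * k * sgn k = int (q * nat \<bar>k\<bar>)" by (simp add: mult.assoc)
  ultimately show ?thesis using u by (simp only: int_pow_pow int_pow_int)
qed

text \<open>If \<open>x\<close> is displaced least by \<open>g\<close>, the translates of \<open>[x, g x]\<close> fit together without
  backtracking unless \<open>g\<close> inverts an edge; this is why only \<open>g\<^sup>2\<close> need fix a vertex.\<close>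

lemma elliptic_or_axis:
  assumes g: "g \<in> carrier G"
  shows "(\<exists>x\<in>V. \<phi> (g [^] (2::nat)) x = x) \<or> (\<exists>A L. axis g A L)"
proof -
  have "V \<noteq> {}" using tree by (simp add: simplicial_tree_def)
  then obtain x where x: "x \<in> V" "\<And>z. z \<in> V \<Longrightarrow> nat (d x (\<phi> g x)) \<le> nat (d z (\<phi> g z))"
    using ex_has_least_nat[of "\<lambda>z. z \<in> V" _ "\<lambda>z. nat (d z (\<phi> g z))"] by blast
  define l where "l = d x (\<phi> g x)"
  have min: "l \<le> d z (\<phi> g z)" if "z \<in> V" for z
    using x(2)[OF that] d_nonneg[of z "\<phi> g z"] unfolding l_def by linarith
  have sq: "\<phi> (g [^] (2::nat)) z = \<phi> g (\<phi> g z)" if "z \<in> V" for z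
    using g that by (simp add: numeral_2_eq_2 action_mult)
  have gx: "\<phi> g x \<in> V" using g x action_closed by blast
  show ?thesis
  proof (cases "l = 0")
    case True
    then have "\<phi> g x = x" using d_eq_0[OF x(1) gx] by (simp add: l_def)
    then show ?thesis using sq x by (metis (no_types))
  next
    case False
    then have l: "l > 0" using d_nonneg[of x "\<phi> g x"] unfolding l_def by linarith
    obtain P where P: "P 0 = x" "P l = \<phi> g x" "\<And>k. 0 \<le> k \<Longrightarrow> k < l \<Longrightarrow> {P k, P (k + 1)} \<in> E"
      "\<And>k. 0 \<le> k \<Longrightarrow> k \<le> l \<Longrightarrow> P k \<in> V"
      "\<And>k m. 0 \<le> k \<Longrightarrow> k \<le> m \<Longrightarrow> m \<le> l \<Longrightarrow> d (P k) (P m) = m - k"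
      using ex_geodesic_isometric[OF x(1) gx, folded l_def] by blast
    show ?thesis
    proof (cases "P (l - 1) = \<phi> g (P 1)")
      case True
      have P1: "P 1 \<in> V" using P(4) l by simp
      \<comment> \<open>Here the path from \<open>x\<close> to \<open>\<phi> g x\<close> and its
        translate by \<open>g\<close> backtrack where they meet. Then \<open>P 1\<close> would be
        displaced by only \<open>l - 2\<close>, less than the minimum, unless \<open>l = 1\<close>;
        in that case \<open>g\<close> swaps the ends of the edge from \<open>x\<close> to
        \<open>\<phi> g x\<close>.\<close>
      have "d (P 1) (P (l - 1)) \<ge> l" using min[OF P1] True by simp
      moreover have "d (P 1) (P (l - 1)) = l - 2" if "l \<ge> 2" using that by (subst P(5)) auto
      ultimately have "l = 1" using l by force
      then have "\<phi> g (\<phi> g x) = x" using True P by simp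
      then show ?thesis using sq x by (metis (no_types))
    next
      case nb: False
      define A where "A i = \<phi> (g [^] (i div l)) (P (i mod l))" for i
      have succ: "\<phi> (g [^] (q + 1)) z = \<phi> (g [^] q) (\<phi> g z)" if "z \<in> V" for q :: int and z
        using g that by (simp add: int_pow_mult int_pow_1 action_mult)
      have succ': "\<phi> (g [^] (q + 1)) z = \<phi> g (\<phi> (g [^] q) z)" if "z \<in> V" for q :: int and z
      proof -
        have "\<phi> (g [^] (1 + q)) z = \<phi> g (\<phi> (g [^] q) z)"
          using g that by (subst int_pow_mult) (simp_all add: int_pow_1 action_mult)
        then show ?thesis by (simp add: add.commute)
      qed
      \<comment> \<open>The case \<open>r = l\<close> is included: there the end of one translate of
        \<open>P\<close> is the start of the next, so edges reaching a junction need no separate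
        treatment.\<close>
      have Aq: "A (q * l + r) = \<phi> (g [^] q) (P r)" if r: "0 \<le> r" "r \<le> l" for q r
      proof (cases "r = l")
        case True
        have "(q * l + r) div l = q + 1" "(q * l + r) mod l = 0" using l True by (simp_all add: algebra_simps)
        then show ?thesis using True P succ[OF x(1)] by (simp add: A_def)
      next
        case False
        then have "(q * l + r) div l = q" "(q * l + r) mod l = r"
          using l r by (simp_all add: div_pos_pos_trivial mod_pos_pos_trivial)
        then show ?thesis by (simp add: A_def)
      qed
      have split: "\<exists>q r. i = q * l + r \<and> 0 \<le> r \<and> r < l" for i
        using l by (intro exI[of _ "i div l"] exI[of _ "i mod l"]) auto
      have "geodesic_line A"
      proof (rule geodesic_lineI)
        fix i
        obtain q r where qr: "i = q * l + r" "0 \<le> r" "r < l" using split by blast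
        have gq: "g [^] q \<in> carrier G" using g by simp
        have Ai: "A i = \<phi> (g [^] q) (P r)" "A (i + 1) = \<phi> (g [^] q) (P (r + 1))"
          using Aq[of r q] Aq[of "r + 1" q] qr by (simp_all add: add.assoc)
        show "{A i, A (i + 1)} \<in> E" unfolding Ai using qr by (intro action_edge[OF gq] P(3)) auto
        show "A i \<noteq> A (i + 2)"
        proof (cases "r + 2 \<le> l")
          case True
          have "A (i + 2) = \<phi> (g [^] q) (P (r + 2))" using Aq[of "r + 2" q] qr True by (simp add: add.assoc)
          moreover have "d (P r) (P (r + 2)) = 2" using P(5)[of r "r + 2"] qr True by simp
          then have "P r \<noteq> P (r + 2)" using P(4)[of r] qr by auto
          ultimately show ?thesis
            using Ai action_inj[OF gq] P(4)[of r] P(4)[of "r + 2"] qr True by (auto simp: inj_on_eq_iff)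
        next
          case False
          \<comment> \<open>Now \<open>A (i + 1)\<close> is a junction of two translates, and not
            turning back there is exactly \<open>nb\<close>, carried along by
            \<open>g [^] q\<close>.\<close>
          then have r: "r = l - 1" using qr by simp
          have "i + 2 = (q + 1) * l + 1" using qr r by (simp add: algebra_simps)
          then have "A (i + 2) = A ((q + 1) * l + 1)" by (rule arg_cong)
          also have "\<dots> = \<phi> (g [^] q) (\<phi> g (P 1))" using Aq[of 1 "q + 1"] l succ P(4)[of 1] by simp
          finally show ?thesis
            using Ai nb r action_inj[OF gq] P(4)[of r] P(4)[of 1] qr l action_closed[OF g]
            by (auto simp: inj_on_eq_iff)
        qed
      qed
      moreover have "\<phi> g (A i) = A (i + l)" for i
      proof -
        obtain q r where qr: "i = q * l + r" "0 \<le> r" "r < l" using split by blast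
        have "i + l = (q + 1) * l + r" using qr by (simp add: algebra_simps)
        then have "A (i + l) = A ((q + 1) * l + r)" by (rule arg_cong)
        then show ?thesis using Aq[of r q] Aq[of r "q + 1"] qr succ'[OF P(4)[of r], of q] by simp
      qed
      ultimately show ?thesis using l unfolding axis_def by blast
    qed
  qed
qed

text \<open>If \<open>v\<close> lies on the side of \<open>x'\<close>, its image lies on the side of
  \<open>\<phi> u x'\<close>, another neighbour of \<open>x\<close>; by
  \<open>neighbour_further\<close> it is then not on the side of \<open>x'\<close>.\<close>

lemma half_tree_moved:
  assumes e: "{x, x'} \<in> E" and u: "u \<in> carrier G" "\<phi> u x = x" "\<phi> u x' \<noteq> x'"
    and v: "v \<in> V" "d v x' \<noteq> d v x + 1"
  shows "d (\<phi> u v) x' = d (\<phi> u v) x + 1"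
proof (rule neighbour_further)
  have V: "x \<in> V" "x' \<in> V" using edgeD e by blast+
  show "{x, \<phi> u x'} \<in> E" using action_edge[OF u(1) e] u by simp
  have "d v x' = d v x - 1" using d_edge_cases[OF v(1) e] v by simp
  then have "d (\<phi> u v) (\<phi> u x') \<le> d (\<phi> u v) (\<phi> u x)" using d_action u(1) V v by simp
  then show "d (\<phi> u v) (\<phi> u x') \<le> d (\<phi> u v) x" using u by simp
qed (use u v e action_closed in auto)

lemma elliptic_elliptic:
  assumes vertex: "\<forall>x\<in>V. power_alternative (G\<lparr>carrier := stabilizer G \<phi> x\<rparr>)"
    and gh: "g \<in> carrier G" "h \<in> carrier G"
    and ell: "\<exists>x\<in>V. \<exists>p::nat\<ge>1. \<phi> (g [^] p) x = x" "\<exists>y\<in>V. \<exists>q::nat\<ge>1. \<phi> (h [^] q) y = y"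
  shows "power_alternative_at G g h"
proof -
  define F where "F u = {x \<in> V. \<exists>p::nat\<ge>1. \<phi> (u [^] p) x = x}" for u
  have "\<exists>xy. xy \<in> F g \<times> F h" using ell by (auto simp: F_def)
  then obtain xy where "xy \<in> F g \<times> F h"
    "\<And>zw. zw \<in> F g \<times> F h \<Longrightarrow> nat (d (fst xy) (snd xy)) \<le> nat (d (fst zw) (snd zw))"
    using ex_has_least_nat[of "\<lambda>xy. xy \<in> F g \<times> F h" _ "\<lambda>xy. nat (d (fst xy) (snd xy))"] by blast
  then obtain x y where xy: "x \<in> F g" "y \<in> F h"
    and min': "\<And>z w. z \<in> F g \<Longrightarrow> w \<in> F h \<Longrightarrow> nat (d x y) \<le> nat (d z w)"
    by (cases xy) auto
  have min: "d x y \<le> d z w" if "z \<in> F g" "w \<in> F h" for z w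
    using min'[OF that] d_nonneg[of z w] by linarith
  have V: "x \<in> V" "y \<in> V" using xy by (auto simp: F_def)
  obtain p q :: nat where pq: "p \<ge> 1" "\<phi> (g [^] p) x = x" "q \<ge> 1" "\<phi> (h [^] q) y = y"
    using xy by (auto simp: F_def)
  have pk: "\<phi> (g [^] (int p * k)) x = x" "\<phi> (h [^] (int q * k)) y = y" for k
    using fixes_int_pow[of "g [^] p" x k] fixes_int_pow[of "h [^] q" y k] pq V gh
    by (simp_all add: int_pow_pow int_pow_int[symmetric])
  show ?thesis
  proof (cases "x = y")
    case True
    have "\<phi> (g [^] (p * q)) x = x" "\<phi> (h [^] (p * q)) x = x"
      using pk(1)[of "int q"] pk(2)[of "int p"] True
      by (simp_all add: int_pow_int[symmetric] mult.commute)
    then show ?thesis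
      using pq gh V by (intro power_alternative_at_subgroup[OF stabilizer_subgroup[OF V(1)]
        vertex[rule_format, OF V(1)], where N = "p * q"]) (auto simp: stabilizer_def)
  next
    case False
    obtain x' where x': "{x, x'} \<in> E" "d x' y = d x y - 1" using ex_closer_neighbour V False by blast
    obtain y' where y': "{y, y'} \<in> E" "d y' x = d y x - 1" using ex_closer_neighbour V False by metis
    have V': "x' \<in> V" "y' \<in> V" using edgeD x' y' by blast+
    have "d x y' = d x y - 1" using y' d_commute V V' by metis
    have mx: "\<phi> (g [^] (int p * k)) x' \<noteq> x'" if "k \<noteq> 0" for k
    proof
      assume "\<phi> (g [^] (int p * k)) x' = x'"
      then have "\<phi> (g [^] (p * nat \<bar>k\<bar>)) x' = x'" by (rule fixes_nat_pow_abs[OF gh(1) V'(1)])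
      moreover have "p * nat \<bar>k\<bar> \<ge> 1" using pq that by simp
      ultimately have "x' \<in> F g" using V' unfolding F_def by blast
      then show False using min[OF _ xy(2)] x' by force
    qed
    have my: "\<phi> (h [^] (int q * k)) y' \<noteq> y'" if "k \<noteq> 0" for k
    proof
      assume "\<phi> (h [^] (int q * k)) y' = y'"
      then have "\<phi> (h [^] (q * nat \<bar>k\<bar>)) y' = y'" by (rule fixes_nat_pow_abs[OF gh(2) V'(2)])
      moreover have "q * nat \<bar>k\<bar> \<ge> 1" using pq that by simp
      ultimately have "y' \<in> F h" using V' unfolding F_def by blast
      then show False using min[OF xy(1)] \<open>d x y' = d x y - 1\<close> by force
    qed
    \<comment> \<open>These are the sides of the two edges containing \<open>y\<close> and
      \<open>x\<close> respectively. They are disjoint: a common vertex would have \<open>x\<close>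
      on its geodesic from \<open>y\<close> and also \<open>y\<close> on its geodesic from
      \<open>x\<close>.\<close>
    define P where "P = {v \<in> V. d v y' = d v y + 1}"
    define Q where "Q = {v \<in> V. d v x' = d v x + 1}"
    have disj: "P \<inter> Q = {}"
    proof (rule ccontr)
      assume "P \<inter> Q \<noteq> {}"
      then obtain v where v: "v \<in> V" "d v y' = d v y + 1" "d v x' = d v x + 1" by (auto simp: P_def Q_def)
      have "d y v = d y x' + 1 + d x v"
        using x' v V V' d_commute by (intro d_through_edge) (auto simp: insert_commute)
      moreover have "d x v = d x y' + 1 + d y v"
        using y' v V V' d_commute by (intro d_through_edge) (auto simp: insert_commute)
      ultimately show False using d_nonneg[of y x'] d_nonneg[of x y'] by linarith
    qed
    have "y \<in> P" using V d_edge[OF y'(1)] by (simp add: P_def)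
    have "\<exists>n::nat\<ge>1. G\<lparr>carrier := generate G {g [^] n, h [^] n}\<rparr> \<cong> F2"
    proof (rule ping_pong_powers[OF gh pq(1,3)])
      show "P \<subseteq> V" "Q \<subseteq> V" "P \<inter> Q = {}" "P \<noteq> {}" using disj \<open>y \<in> P\<close> by (auto simp: P_def Q_def)
      fix k :: int and v assume k: "k \<noteq> 0"
      show "\<phi> (g [^] (int p * k)) v \<in> Q" if "v \<in> P"
        using half_tree_moved[OF x'(1) _ pk(1) mx[OF k], of v] that disj gh action_closed
        by (auto simp: P_def Q_def)
      show "\<phi> (h [^] (int q * k)) v \<in> P" if "v \<in> Q"
        using half_tree_moved[OF y'(1) _ pk(2) my[OF k], of v] that disj gh action_closed
        by (auto simp: P_def Q_def)
    qed
    then show ?thesis unfolding power_alternative_at_def by blast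
  qed
qed

section \<open>Projections onto axes\<close>

lemma axis_shift: "axis g A L \<Longrightarrow> axis g (\<lambda>i. A (i + m)) L"
  by (auto simp: axis_def geodesic_line_shift algebra_simps)

lemma proj_shift:
  assumes A: "geodesic_line A" and v: "v \<in> V"
  shows "proj (\<lambda>i. A (i + m)) v = proj A v - m"
proof (rule proj_eqI[OF geodesic_line_shift[OF A] v])
  show "d v (A (j + m)) = d v (A (proj A v)) + \<bar>j - (proj A v - m)\<bar>" for j
    using d_proj[OF A v, of "j + m"] by (simp add: algebra_simps)
qed

lemma proj_axis_pow:
  assumes g: "g \<in> carrier G" and ax: "axis g A L" and v: "v \<in> V"
  shows "proj A (\<phi> (g [^] (k::int)) v) = proj A v + k * L"
proof (rule proj_eqI)
  show A: "geodesic_line A" using ax by (simp add: axis_def)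
  have gk: "g [^] k \<in> carrier G" using g by simp
  show "\<phi> (g [^] k) v \<in> V" using action_closed[OF gk v] .
  fix j
  have "A j = \<phi> (g [^] k) (A (j - k * L))" using axis_pow[OF g ax, of k "j - k * L"] by simp
  then have "d (\<phi> (g [^] k) v) (A j) = d v (A (j - k * L))"
    using d_action[OF gk v] geodesic_lineD(1)[OF A] by simp
  then show "d (\<phi> (g [^] k) v) (A j) = d v (A (proj A v)) + \<bar>j - (proj A v + k * L)\<bar>"
    using d_proj[OF A v, of "j - k * L"] by (simp add: algebra_simps)
qed

text \<open>A nonzero power of \<open>g [^] (2 * M + 1)\<close> shifts indices by at least
  \<open>2 * M + 1\<close>, as \<open>L \<ge> 1\<close>, and this moves the interval from
  \<open>- M\<close> to \<open>M\<close> off itself.\<close>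

lemma proj_axis_large_pow:
  assumes g: "g \<in> carrier G" and ax: "axis g A L" and v: "v \<in> V" and M: "\<bar>proj A v\<bar> \<le> M"
    and k: "k \<noteq> (0::int)"
  shows "\<bar>proj A (\<phi> (g [^] (int (nat (2 * M + 1)) * k)) v)\<bar> > M"
proof -
  have L: "L > 0" using ax by (simp add: axis_def)
  define z where "z = (2 * M + 1) * k * L"
  have "\<bar>k\<bar> * L \<ge> 1" using L k by (simp add: int_one_le_iff_zero_less)
  then have "(2 * M + 1) * 1 \<le> (2 * M + 1) * (\<bar>k\<bar> * L)" using M by (intro mult_left_mono) auto
  also have "\<dots> = \<bar>z\<bar>" using L M by (simp add: z_def abs_mult)
  finally have "\<bar>z\<bar> \<ge> 2 * M + 1" by simp
  moreover have "proj A (\<phi> (g [^] (int (nat (2 * M + 1)) * k)) v) = proj A v + z"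
    using proj_axis_pow[OF g ax v] M by (simp add: z_def)
  ultimately show ?thesis using M by linarith
qed

lemma bounded_displacement_axis_pow:
  assumes g: "g \<in> carrier G" and ax: "axis g A L"
  shows "bounded_displacement (g [^] (n::nat)) A"
proof -
  have A: "geodesic_line A" using ax by (simp add: axis_def)
  have "\<phi> (g [^] n) (A i) = A (i + int n * L)" for i
    using axis_pow[OF g ax, of "int n" i] by (simp add: int_pow_int)
  then have "d (A i) (\<phi> (g [^] n) (A i)) \<le> \<bar>int n * L\<bar>" for i by (simp add: geodesic_lineD[OF A])
  then show ?thesis unfolding bounded_displacement_def by blast
qed

text \<open>If \<open>w\<close> reverses a long segment of the axis, then \<open>g w g w\<^sup>-\<^sup>1\<close> fixes a long segment, hence the
  whole axis, and so \<open>w\<close> conjugates the translation into its inverse.\<close>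

lemma reverses_axis:
  assumes g: "g \<in> carrier G" and ax: "axis g A L" and w: "w \<in> carrier G"
    and M: "M \<ge> 0" "\<And>u i. u \<in> carrier G \<Longrightarrow> \<phi> u (A i) = A i \<Longrightarrow> \<phi> u (A (i + M)) = A (i + M) \<Longrightarrow>
      (\<forall>j. \<phi> u (A j) = A j)"
    and rev: "\<And>t. 0 \<le> t \<Longrightarrow> t \<le> M + L \<Longrightarrow> \<phi> w (A t) = A (- t)"
  shows "\<phi> w (A t) = A (- t)"
proof -
  have A: "geodesic_line A" and L: "L > 0" and gA: "\<And>i. \<phi> g (A i) = A (i + L)"
    using ax by (auto simp: axis_def)
  note AV = geodesic_lineD(1)[OF A]
  define c where "c = g \<otimes> (w \<otimes> (g \<otimes> inv w))"
  have c: "c \<in> carrier G" using g w by (simp add: c_def)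
  have cA: "\<phi> c (A i) = \<phi> g (\<phi> w (\<phi> g (\<phi> (inv w) (A i))))" for i
    using g w AV by (simp add: c_def action_mult action_closed)
  have iw: "\<phi> (inv w) (A (- t)) = A t" if "\<phi> w (A t) = A (- t)" for t
    using action_inv_left[OF w AV, of t] that by simp
  \<comment> \<open>The reversal is applied at \<open>t\<close> and at \<open>t + L\<close>; this is
    why \<open>rev\<close> reaches up to \<open>M + L\<close>.\<close>
  have "\<phi> c (A (- t)) = A (- t)" if "0 \<le> t" "t \<le> M" for t
    using iw[OF rev, of t] rev[of "t + L"] that L by (simp add: cA gA)
  from this[of 0] this[of M] have "\<phi> c (A 0) = A 0" "\<phi> c (A (- M)) = A (- M)" using M(1) by simp_all
  then have "\<forall>j. \<phi> c (A j) = A j" by (intro M(2)[OF c, of "- M"]) simp_all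
  then have fixc: "\<phi> c (A j) = A j" for j by blast
  have injw: "a = b" if "\<phi> w a = \<phi> w b" "a \<in> V" "b \<in> V" for a b
    using action_inj[OF w] that by (simp add: inj_on_eq_iff)
  have injg: "a = b" if "\<phi> g a = \<phi> g b" "a \<in> V" "b \<in> V" for a b
    using action_inj[OF g] that by (simp add: inj_on_eq_iff)
  \<comment> \<open>Since \<open>c\<close> fixes the axis, reversal at index \<open>t\<close> forces
    it at \<open>t + L\<close>, and conversely. The indices from 0 to \<open>L - 1\<close> are
    reversed by assumption and represent all residues modulo \<open>L\<close>.\<close>
  have up: "\<phi> w (A (t + L)) = A (- (t + L))" if t: "\<phi> w (A t) = A (- t)" for t
  proof -
    have "\<phi> g (\<phi> w (A (t + L))) = \<phi> g (A (- (t + L)))"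
      using fixc[of "- t"] iw[OF t] by (simp add: cA gA)
    then show ?thesis by (rule injg) (auto simp: action_closed[OF w] AV)
  qed
  have down: "\<phi> w (A t) = A (- t)" if t: "\<phi> w (A (t + L)) = A (- (t + L))" for t
  proof -
    let ?z = "\<phi> (inv w) (A (- t))"
    have z: "?z \<in> V" using w AV by (simp add: action_closed)
    have "\<phi> g (\<phi> w (\<phi> g ?z)) = \<phi> g (A (- (t + L)))" using fixc[of "- t"] by (simp add: cA gA)
    then have "\<phi> w (\<phi> g ?z) = A (- (t + L))"
      by (rule injg) (use z in \<open>auto simp: action_closed[OF w] action_closed[OF g] AV\<close>)
    then have "\<phi> w (\<phi> g ?z) = \<phi> w (A (t + L))" using t by simp
    then have "\<phi> g ?z = A (t + L)"
      by (rule injw) (use z in \<open>auto simp: action_closed[OF g] AV\<close>)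
    then have "\<phi> g ?z = \<phi> g (A t)" by (simp only: gA)
    then have "?z = A t" by (rule injg) (use z AV in auto)
    then show ?thesis using action_inv_right[OF w AV, of "- t"] by simp
  qed
  have all: "\<phi> w (A (q * L + r)) = A (- (q * L + r))" if r: "0 \<le> r" "r < L" for q r
  proof (induction q rule: int_induct[of _ 0])
    case base
    show ?case using rev[of r] r M(1) by simp
  next
    case (step1 i)
    then show ?case using up[of "i * L + r"] by (simp add: algebra_simps)
  next
    case (step2 i)
    then show ?case using down[of "(i - 1) * L + r"] by (simp add: algebra_simps)
  qed
  show ?thesis using all[of "t mod L" "t div L"] L by simp
qed

section \<open>An axis and a fixed vertex\<close>

lemma axis_elliptic:
  assumes stab: "stabilisation_property G X D \<psi>"
    and boundary: "\<forall>\<xi>\<in>gromov_boundary X D.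
      power_alternative (G\<lparr>carrier := stabilizer G (boundary_action \<psi>) \<xi>\<rparr>)"
    and gh: "g \<in> carrier G" "h \<in> carrier G" and ax0: "axis g A0 L"
    and ell: "y \<in> V" "(q::nat) \<ge> 1" "\<phi> (h [^] q) y = y"
  shows "power_alternative_at G g h"
proof -
  define A where "A = (\<lambda>i. A0 (i + proj A0 y))"
  have ax: "axis g A L" unfolding A_def by (rule axis_shift[OF ax0])
  have A: "geodesic_line A" and L: "L > 0" using ax by (auto simp: axis_def)
  note AV = geodesic_lineD(1)[OF A]
  have y0: "proj A y = 0" unfolding A_def using ax0 ell by (subst proj_shift) (auto simp: axis_def)
  obtain M0 where M0: "M0 \<ge> 0" "\<And>u i. u \<in> carrier G \<Longrightarrow> \<phi> u (A i) = A i \<Longrightarrow>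
      \<phi> u (A (i + M0)) = A (i + M0) \<Longrightarrow> (\<forall>j. \<phi> u (A j) = A j)"
    using fixes_long_segment_imp_fixes_axis[OF stab gh(1) ax] by metis
  \<comment> \<open>\<open>M0\<close> is a length such that fixing a segment of that length means
    fixing the axis; the extra \<open>L\<close> is what \<open>reverses_axis\<close>
    requires.\<close>
  define M where "M = M0 + L"
  have M: "M > 0" "M0 \<le> M" using M0 L by (auto simp: M_def)
  define b where "b k = h [^] (int q * k)" for k
  have b: "b k \<in> carrier G" for k using gh by (simp add: b_def)
  have by_: "\<phi> (b k) y = y" for k
    using fixes_int_pow[of "h [^] q" y k] ell gh
    by (simp add: b_def int_pow_pow int_pow_int[symmetric])
  show ?thesis
  proof (cases "\<exists>k. k \<noteq> 0 \<and> (\<forall>j. \<phi> (b k) (A j) = A j)")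
    case True
    then obtain k where k: "k \<noteq> 0" "\<And>j. \<phi> (b k) (A j) = A j" by blast
    let ?N = "q * nat \<bar>k\<bar>"
    have "\<phi> (h [^] ?N) (A j) = A j" for j
      using fixes_nat_pow_abs[OF gh(2) AV k(2)[unfolded b_def]] .
    then have "bounded_displacement (h [^] ?N) A"
      unfolding bounded_displacement_def using AV by (intro exI[of _ 0]) simp
    moreover have "?N \<ge> 1" using k ell by simp
    ultimately show ?thesis
      using end_alternative[OF boundary A gh] bounded_displacement_axis_pow[OF gh(1) ax] by blast
  next
    case False
    then have nofix: "\<not> (\<forall>j. \<phi> (b k) (A j) = A j)" if "k \<noteq> 0" for k using that by blast
    \<comment> \<open>If \<open>b k\<close> left some vertex far out, it would carry the part of the
      axis leading from \<open>A 0\<close> towards that vertex onto another part starting at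
      \<open>A 0\<close>. In the same direction it fixes a long segment, hence the axis; in the
      opposite one it reverses the axis and its square fixes it.\<close>
    have small: "\<bar>proj A (\<phi> (b k) v)\<bar> \<le> M" if k: "k \<noteq> 0" and v: "v \<in> V" "\<bar>proj A v\<bar> > M" for k v
    proof (rule ccontr)
      let ?u = "b k" and ?v = "\<phi> (b k) v"
      assume "\<not> \<bar>proj A ?v\<bar> \<le> M"
      then have large: "\<bar>proj A ?v\<bar> > M" by simp
      define s s' where "s = sgn (proj A v)" and "s' = sgn (proj A ?v)"
      have s: "s = 1 \<or> s = -1" "s' = 1 \<or> s' = -1" using v large M by (auto simp: s_def s'_def sgn_if)
      have uv: "?v \<in> V" using action_closed[OF b v(1)] .
      have pv: "proj A v = s * \<bar>proj A v\<bar>" "proj A ?v = s' * \<bar>proj A ?v\<bar>"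
        by (simp_all add: s_def s'_def sgn_mult_abs)
      \<comment> \<open>\<open>?u\<close> fixes \<open>y\<close>, so both points lie on the geodesic
        from \<open>y\<close> to \<open>?v\<close>, at the same distance from
        \<open>y\<close>.\<close>
      have img: "\<phi> ?u (A (s * t)) = A (s' * t)" if t: "0 \<le> t" "t \<le> M" for t
      proof (rule geodesic_point_unique[OF ell(1) uv])
        have t': "t \<le> \<bar>proj A v\<bar>" "0 < \<bar>proj A v\<bar>" "t \<le> \<bar>proj A ?v\<bar>" "0 < \<bar>proj A ?v\<bar>"
          using t v large M by linarith+
        note 1 = line_on_geodesic[OF A ell(1) v(1) s(1) y0 pv(1) t(1) t'(1,2)]
        note 2 = line_on_geodesic[OF A ell(1) uv s(2) y0 pv(2) t(1) t'(3,4)]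
        have e: "d y (\<phi> ?u a) = d y a" "d (\<phi> ?u a) ?v = d a v" if "a \<in> V" for a
          using d_action[OF b ell(1) that, of k] d_action[OF b that v(1), of k] by_ by auto
        show "\<phi> ?u (A (s * t)) \<in> V" "A (s' * t) \<in> V" using action_closed[OF b] AV by auto
        show "d y (\<phi> ?u (A (s * t))) + d (\<phi> ?u (A (s * t))) ?v = d y ?v"
          using 1(3) e AV e(1)[OF v(1)] by simp
        show "d y (A (s' * t)) + d (A (s' * t)) ?v = d y ?v" using 2(3) .
        show "d y (\<phi> ?u (A (s * t))) = d y (A (s' * t))" using 1(1) 2(1) e AV by simp
      qed
      show False
      proof (cases "s = s'")
        case True
        have f: "\<phi> ?u (A 0) = A 0" "\<phi> ?u (A (s * M0)) = A (s * M0)"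
          using img[of 0] img[of M0] True M0 M by auto
        have "\<forall>j. \<phi> ?u (A j) = A j"
          using s(1)
        proof
          assume "s = 1"
          then show ?thesis using M0(2)[OF b, of k 0] f by simp
        next
          assume "s = -1"
          then show ?thesis using M0(2)[OF b, of k "- M0"] f by simp
        qed
        then show False using nofix[OF k] by blast
      next
        case False
        then have s'_eq: "s' = - s" using s by auto
        have flip: "\<phi> ?u (A t) = A (- t)" for t
          using s(1)
        proof
          assume "s = 1"
          then have "\<phi> ?u (A t) = A (- t)" if "0 \<le> t" "t \<le> M0 + L" for t
            using img[of t] that s'_eq by (simp add: M_def)
          with M0 show ?thesis by (rule reverses_axis[OF gh(1) ax b])
        next
          assume s1: "s = -1"
          \<comment> \<open>With \<open>s = -1\<close> it is on negative indices that
            \<open>?u\<close> is known to reverse, so \<open>reverses_axis\<close> is applied to its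
            inverse.\<close>
          have "\<phi> (inv ?u) (A t) = A (- t)" if "0 \<le> t" "t \<le> M0 + L" for t
            using img[of t] that s1 s'_eq action_inv_left[OF b AV, of k "- t"] by (simp add: M_def)
          with M0 have "\<phi> (inv ?u) (A (- t)) = A (- (- t))"
            by (rule reverses_axis[OF gh(1) ax inv_closed[OF b]])
          then show ?thesis using action_inv_right[OF b AV, of k "- t"] by simp
        qed
        have "b (2 * k) = ?u \<otimes> ?u" using gh by (simp add: b_def int_pow_mult[symmetric] mult.left_commute mult.commute)
        then have "\<phi> (b (2 * k)) (A j) = A j" for j using b AV flip by (simp add: action_mult)
        then show False using nofix[of "2 * k"] k by simp
      qed
    qed
    define P where "P = {v \<in> V. \<bar>proj A v\<bar> \<le> M}"
    define Q where "Q = {v \<in> V. \<bar>proj A v\<bar> > M}"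
    have "\<exists>n::nat\<ge>1. G\<lparr>carrier := generate G {g [^] n, h [^] n}\<rparr> \<cong> F2"
    proof (rule ping_pong_powers[OF gh _ ell(2)])
      show "nat (2 * M + 1) \<ge> 1" using M by simp
      show "P \<subseteq> V" "Q \<subseteq> V" "P \<inter> Q = {}" by (auto simp: P_def Q_def)
      show "P \<noteq> {}" using ell y0 M by (auto simp: P_def intro!: exI[of _ y])
      fix k :: int and v assume k: "k \<noteq> 0"
      show "\<phi> (g [^] (int (nat (2 * M + 1)) * k)) v \<in> Q" if "v \<in> P"
        using that proj_axis_large_pow[OF gh(1) ax _ _ k, of v M] gh action_closed
        by (auto simp: P_def Q_def)
      show "\<phi> (h [^] (int q * k)) v \<in> P" if "v \<in> Q"
        using that small[OF k, of v] action_closed[OF b] by (auto simp: P_def Q_def b_def)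
    qed
    then show ?thesis unfolding power_alternative_at_def by blast
  qed
qed

section \<open>Two axes\<close>

lemma axis_axis:
  assumes boundary: "\<forall>\<xi>\<in>gromov_boundary X D.
      power_alternative (G\<lparr>carrier := stabilizer G (boundary_action \<psi>) \<xi>\<rparr>)"
    and gh: "g \<in> carrier G" "h \<in> carrier G" and axA: "axis g A L" and axB0: "axis h B0 L'"
  shows "power_alternative_at G g h"
proof -
  \<comment> \<open>Indices on \<open>B\<close> are shifted so that \<open>A 0\<close> projects to
    \<open>B 0\<close>; thus \<open>e\<close> below is the distance from \<open>A 0\<close> to the
    line \<open>B\<close>.\<close>
  define B where "B = (\<lambda>i. B0 (i + proj B0 (A 0)))"
  have axB: "axis h B L'" unfolding B_def by (rule axis_shift[OF axB0])
  have A: "geodesic_line A" and B: "geodesic_line B" using axA axB by (auto simp: axis_def)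
  note AV = geodesic_lineD(1)[OF A] and BV = geodesic_lineD(1)[OF B]
  have A0: "proj A (A 0) = 0" using proj_line[OF A] .
  have B0: "proj B (A 0) = 0" unfolding B_def using axB0 AV by (subst proj_shift) (auto simp: axis_def)
  define e where "e = d (A 0) (B 0)"
  have e0: "e \<ge> 0" by (simp add: e_def)
  show ?thesis
  proof (cases "\<exists>M\<ge>0. \<forall>v\<in>V. \<bar>proj A v\<bar> \<le> M \<or> \<bar>proj B v\<bar> \<le> M")
    case True
    then obtain M where M: "M \<ge> 0" "\<And>v. v \<in> V \<Longrightarrow> \<bar>proj A v\<bar> \<le> M \<or> \<bar>proj B v\<bar> \<le> M" by blast
    define P where "P = {v \<in> V. \<bar>proj B v\<bar> > M}"
    define Q where "Q = {v \<in> V. \<bar>proj A v\<bar> > M}"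
    have "\<exists>n::nat\<ge>1. G\<lparr>carrier := generate G {g [^] n, h [^] n}\<rparr> \<cong> F2"
    proof (rule ping_pong_powers[OF gh])
      show "nat (2 * M + 1) \<ge> 1" "nat (2 * M + 1) \<ge> 1" using M by auto
      show "P \<subseteq> V" "Q \<subseteq> V" by (auto simp: P_def Q_def)
      show "P \<inter> Q = {}" using M(2) by (force simp: P_def Q_def)
      have "B (M + 1) \<in> P" using BV proj_line[OF B] M by (simp add: P_def)
      then show "P \<noteq> {}" by blast
      fix k :: int and v assume k: "k \<noteq> 0"
      show "\<phi> (g [^] (int (nat (2 * M + 1)) * k)) v \<in> Q" if "v \<in> P"
        using that proj_axis_large_pow[OF gh(1) axA _ _ k, of v M] M(2)[of v] gh action_closed
        by (auto simp: P_def Q_def)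
      show "\<phi> (h [^] (int (nat (2 * M + 1)) * k)) v \<in> P" if "v \<in> Q"
        using that proj_axis_large_pow[OF gh(2) axB _ _ k, of v M] M(2)[of v] gh action_closed
        by (auto simp: P_def Q_def)
    qed
    then show ?thesis unfolding power_alternative_at_def by blast
  next
    case False
    define R where "R s s' t \<longleftrightarrow> A (s * t) = B (s' * (t - e))" for s s' t
    \<comment> \<open>Let \<open>v\<close> project far out on both lines. The geodesic from
      \<open>A 0\<close> to \<open>v\<close> starts along \<open>A\<close> and, having reached
      \<open>B 0\<close> after \<open>e\<close> steps, runs along \<open>B\<close>. From step
      \<open>e\<close> to step \<open>M\<close> the lines therefore coincide, up to the directions
      \<open>s\<close> and \<open>s'\<close>.\<close>
    have overlap: "\<exists>s\<in>{1, -1}. \<exists>s'\<in>{1, -1}. \<forall>t. e \<le> t \<and> t \<le> M \<longrightarrow> R s s' t" if M: "M \<ge> 0" for M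
    proof -
      obtain v where v: "v \<in> V" "\<bar>proj A v\<bar> > M" "\<bar>proj B v\<bar> > M" using False M by force
      define s s' where "s = sgn (proj A v)" and "s' = sgn (proj B v)"
      have s: "s = 1 \<or> s = -1" "s' = 1 \<or> s' = -1" using v M by (auto simp: s_def s'_def sgn_if)
      have pv: "proj A v = s * \<bar>proj A v\<bar>" "proj B v = s' * \<bar>proj B v\<bar>"
        by (simp_all add: s_def s'_def sgn_mult_abs)
      have "R s s' t" if t: "e \<le> t" "t \<le> M" for t
        unfolding R_def
      proof (rule geodesic_point_unique[OF AV v(1) AV BV])
        have t': "0 \<le> t" "t \<le> \<bar>proj A v\<bar>" "0 < \<bar>proj A v\<bar>"
          "0 \<le> t - e" "t - e \<le> \<bar>proj B v\<bar>" "0 < \<bar>proj B v\<bar>" using t v M e0 by linarith+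
        note 1 = line_on_geodesic[OF A AV v(1) s(1) A0 pv(1) t'(1-3)]
        note 2 = line_on_geodesic[OF B AV v(1) s(2) B0 pv(2) t'(4-6)]
        show "d (A 0) (A (s * t)) + d (A (s * t)) v = d (A 0) v" using 1(3) .
        show "d (A 0) (B (s' * (t - e))) + d (B (s' * (t - e))) v = d (A 0) v" using 2(3) .
        show "d (A 0) (A (s * t)) = d (A 0) (B (s' * (t - e)))" using 1(1) 2(1) AV by (simp add: e_def)
      qed
      then show ?thesis using s by blast
    qed
    \<comment> \<open>The directions found by \<open>overlap\<close> may depend on \<open>M\<close>.
      There are only four pairs, so if each failed at some index, taking \<open>M\<close> to be the
      largest of these four indices would contradict \<open>overlap\<close>.\<close>
    have "\<exists>s\<in>{1, -1}. \<exists>s'\<in>{1, -1}. \<forall>t\<ge>e. R s s' t"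
    proof (rule ccontr)
      assume "\<not> ?thesis"
      then have "\<forall>s\<in>{1, -1}. \<forall>s'\<in>{1, -1}. \<exists>t\<ge>e. \<not> R s s' t" by blast
      then obtain T where T: "\<And>s s'. s \<in> {1, -1} \<Longrightarrow> s' \<in> {1, -1} \<Longrightarrow> T s s' \<ge> e \<and> \<not> R s s' (T s s')"
        by metis
      define M where "M = Max ((\<lambda>(s, s'). T s s') ` ({1, -1} \<times> {1, -1}))"
      have le: "T s s' \<le> M" if "s \<in> {1, -1}" "s' \<in> {1, -1}" for s s'
        unfolding M_def using that by (intro Max_ge) auto
      have "M \<ge> 0" using le[of 1 1] T[of 1 1] e0 by simp
      then obtain s s' where s: "s \<in> {1, -1}" "s' \<in> {1, -1}" and "\<forall>t. e \<le> t \<and> t \<le> M \<longrightarrow> R s s' t"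
        using overlap by blast
      then have "R s s' (T s s')" using T[OF s] le[OF s] by blast
      then show False using T[OF s] by blast
    qed
    then obtain s s' where s: "s = 1 \<or> s = -1" "s' = 1 \<or> s' = -1"
      and R: "\<And>t. t \<ge> e \<Longrightarrow> A (s * t) = B (s' * (t - e))" unfolding R_def by blast
    \<comment> \<open>On nonnegative indices \<open>A'\<close> is the common ray: as part of
      \<open>A\<close> it is displaced by \<open>g\<close> by \<open>L\<close>, and as part of
      \<open>B\<close> it is displaced by \<open>h\<close> by \<open>L'\<close>.\<close>
    define A' where "A' i = A (s * (i + e))" for i
    have A': "geodesic_line A'"
      using s geodesic_line_shift[OF A, of e] geodesic_line_shift[OF geodesic_line_reverse[OF A], of e]
      by (auto simp: A'_def[abs_def] algebra_simps)
    have gA: "\<phi> g (A i) = A (i + L)" for i using axA by (simp add: axis_def)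
    have hB: "\<phi> h (B i) = B (i + L')" for i using axB by (simp add: axis_def)
    have "d (A' i) (\<phi> g (A' i)) \<le> \<bar>L\<bar>" for i by (simp add: A'_def gA geodesic_lineD[OF A])
    then have "bounded_displacement (g [^] (1::nat)) A'"
      using gh unfolding bounded_displacement_def by auto
    moreover have "A' i = B (s' * i)" if "i \<ge> 0" for i using R[of "i + e"] that by (simp add: A'_def)
    then have "d (A' i) (\<phi> h (A' i)) \<le> \<bar>L'\<bar>" if "i \<ge> 0" for i
      using that by (simp add: hB geodesic_lineD[OF B])
    then have "bounded_displacement (h [^] (1::nat)) A'"
      using gh unfolding bounded_displacement_def by auto
    ultimately show ?thesis using end_alternative[OF boundary A' gh, of 1] by simp
  qed
qed

lemma power_alternative_at_commute:
  assumes "power_alternative_at G g h"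
  shows "power_alternative_at G h g"
proof -
  obtain n :: nat where "n \<ge> 1" "g [^] n \<otimes> h [^] n = h [^] n \<otimes> g [^] n \<or>
      G\<lparr>carrier := generate G {g [^] n, h [^] n}\<rparr> \<cong> F2"
    using assms unfolding power_alternative_at_def by blast
  moreover have "{g [^] n, h [^] n} = {h [^] n, g [^] n}" by (rule insert_commute)
  ultimately show ?thesis unfolding power_alternative_at_def by (intro exI[of _ n]) auto
qed

end

theorem theorem1:
  fixes G :: "('g, 'm) monoid_scheme"
    and V :: "'v set" and E :: "'v set set"
    and \<phi> :: "'g \<Rightarrow> 'v \<Rightarrow> 'v"
  assumes tree: "simplicial_tree V E"
    and action: "group_action G V \<phi>"
    and automorphisms: "\<forall>g\<in>carrier G. graph_automorphism V E (\<phi> g)"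
    and vertex_stabilisers:
      "\<forall>x\<in>V. power_alternative (G\<lparr>carrier := stabilizer G \<phi> x\<rparr>)"
    and boundary_stabilisers:
      "\<forall>\<xi>\<in>gromov_boundary (realisation V E) (path_metric V E).
        power_alternative
          (G\<lparr>carrier := stabilizer G (boundary_action (realised_action V E \<phi>)) \<xi>\<rparr>)"
    and stabilisation:
      "stabilisation_property G (realisation V E) (path_metric V E) (realised_action V E \<phi>)"
  shows "power_alternative G"
proof -
  interpret tree_action V E G \<phi>
    using tree action automorphisms
    by (simp add: tree_action_def tree_graph_def tree_action_axioms_def)
  have "power_alternative_at G g h" if gh: "g \<in> carrier G" "h \<in> carrier G" for g h
  proof -
    let ?ell = "\<lambda>u. \<exists>x\<in>V. \<exists>p::nat\<ge>1. \<phi> (u [^]\<^bsub>G\<^esub> p) x = x"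
    let ?hyp = "\<lambda>u. \<exists>A L. axis u A L"
    have dich: "?ell u \<or> ?hyp u" if "u \<in> carrier G" for u
      using elliptic_or_axis[OF that] one_le_numeral by blast
    consider "?ell g" "?ell h" | "?hyp g" "?hyp h" | "?hyp g" "?ell h" | "?ell g" "?hyp h"
      using dich[OF gh(1)] dich[OF gh(2)] by argo
    then show ?thesis
    proof cases
      case 1
      then show ?thesis by (rule elliptic_elliptic[OF vertex_stabilisers gh])
    next
      case 2
      then show ?thesis using axis_axis[OF boundary_stabilisers gh] by blast
    next
      case 3
      then show ?thesis using axis_elliptic[OF stabilisation boundary_stabilisers gh] by blast
    next
      case 4
      then show ?thesis
        using axis_elliptic[OF stabilisation boundary_stabilisers gh(2,1)]
        by (blast intro: power_alternative_at_commute)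
    qed
  qed
  then show ?thesis unfolding power_alternative_def power_alternative_at_def by blast
qed

end
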